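(* Let $\nu\in\{\alpha,\beta,\gamma\}$ and $n\ge1$, and if $\nu=\gamma$ assume moreover that $\phi_n^\nu$ is regular, i.e. $p_n^{*}(\gamma_{n-1})\ne0$ where $p_n=\phi_n\pi_n$. Then, with initial condition $\phi_0^\nu=\phi_0^{\nu*}=1$, the following recursion holds: $$\begin{bmatrix}\phi_n^\nu(z)\\ \phi_n^{\nu*}(z)\end{bmatrix}=H_n^\nu\,\frac{\varpi_{n-1}^\nu(z)}{\varpi_n^\nu(z)}\begin{bmatrix}1&\lambda_n^\nu\\ \overline{\lambda_n^\nu}&1\end{bmatrix}\begin{bmatrix}\zeta_{n-1}^\nu(z)&0\\0&1\end{bmatrix}\begin{bmatrix}\phi_{n-1}^\nu(z)\\ \phi_{n-1}^{\nu*}(z)\end{bmatrix},$$ where $H_n^\nu$ is a nonzero constant times a unitary matrix, $$H_n^\nu=e_n^\nu\begin{bmatrix}\eta_{n1}^\nu&0\\0&\eta_{n2}^\nu\end{bmatrix},\qquad e_n^\nu\in\mathbb C\setminus\{0\},\quad \eta_{n1}^\nu,\eta_{n2}^\nu\in\mathbb T.$$ The constant $\eta_{n1}^\nu$ is chosen such that the normalization condition of the orthonormal functions is maintained, and then $\eta_{n2}^\nu=\overline{\eta_{n1}^\nu}\,\overline{\sigma}_{n-1}\sigma_n$. The parameter $\lambda_n^\nu$ is given by $$\lambda_n^\nu=\eta_n^\nu\,\frac{p_n^\nu(\nu_{n-1})}{\overline{p_n^{\nu*}(\nu_{n-1})}}\qquad\text{with}\qquad \eta_n^\nu=\overline{\varsigma}_{n-2}\,\frac{\overline{p_{n-1}^{\nu*}(\nu_{n-1})}}{p_{n-1}^{\nu*}(\nu_{n-1})}\in\mathbb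 T,$$ where $\phi_k^\nu=p_k^\nu/\pi_k^\nu$.
   Context: Notation: $\mathbb D$ is the open unit disk, $\mathbb T$ the unit circle, $f_*(z)=\overline{f(1/\overline z)}$. Poles. $(\alpha_j)_{j\ge1}$ is an arbitrary sequence in $\mathbb D$, $\beta_j=1/\overline{\alpha}_j$ ($\beta_j=\infty$ if $\alpha_j=0$), $\alpha_0=0$, $\beta_0=\infty$. $(\gamma_j)_{j\ge0}$ is a sequence with $\gamma_j\in\{\alpha_j,\beta_j\}$ for each $j$, chosen arbitrarily. Put $\mathbb a_n=\{1\le j\le n:\gamma_j=\alpha_j\}$, $\mathbb b_n=\{1\le j\le n:\gamma_j=\beta_j\}$. Let $\sigma_j=\overline{\alpha}_j/|\alpha_j|$ if $\alpha_j\neq0$, $\sigma_j=1$ if $\alpha_j=0$; $\varsigma_n=\prod_{j=1}^n\sigma_j$ for $n\ge 1$, $\varsigma_0=\varsigma_{-1}=1$. For $\nu\in\{\alpha,\beta,\gamma\}$ let $\varpi_j^\nu(z)=1-\overline{\nu}_jz$ and $\varpi_j^{\nu*}(z)=z-\nu_j$ if $\nu_j\ne\infty$, and $\varpi_j^\nu(z)=-z$, $\varpi_j^{\nu*}(z)=-1$ if $\nu_j=\infty$; $\zeta_j^\nu=\sigma_j\varpi_j^{\nu*}/\varpi_j^\nu$; $\pi_n^\nu=\prod_{j=1}^n\varpi_j^\nu$. The superscript $\gamma$ is often omitted. Spaces (empty products are $1$). $B_n^\nu=\prod_{j=1}^n\zeta_j^\nu$ for $\nu\in\{\alpha,\beta\}$;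 $\dot B_n^\alpha=\prod_{j\in\mathbb a_n}\zeta_j^\alpha$, $\dot B_n^\beta=\prod_{j\in\mathbb b_n}\zeta_j^\beta$; $B_0=1$, and $B_n=B_n^\gamma=\dot B_n^\alpha$ if $\gamma_n=\alpha_n$, $=\dot B_n^\beta$ if $\gamma_n=\beta_n$. $\mathcal L_n^\nu=\mathrm{span}\{B_0^\nu,\dots,B_n^\nu\}$ for $\nu\in\{\alpha,\beta,\gamma\}$ (equivalently $\{p/\pi_n^\nu: p \text{ polynomial of degree}\le n\}$). Orthonormal functions. $\mu$ is a probability measure positive a.e. on $\mathbb T$, $\langle f,g\rangle=\int_{\mathbb T}\overline f g\,d\mu$. $\phi_0^\nu=1$; for $n\ge1$, $\phi_n^\nu\in\mathcal L_n^\nu\setminus\mathcal L_{n-1}^\nu$, $\phi_n^\nu\perp\mathcal L_{n-1}^\nu$, $\|\phi_n^\nu\|=1$. Reciprocals: $\phi_n^{\nu*}=B_n^\nu(\phi_n^\nu)_*$ for $\nu\in\{\alpha,\beta\}$, and $\phi_n^{\gamma*}=\phi_n^*=\dot B_n^\alpha\dot B_n^\beta(\phi_n)_*$. Normalization condition: $\phi_n^{\alpha*}(\alpha_n)>0$, $\phi_n^{\beta*}(\beta_n)>0$, and $(\phi_n^*/\dot B_n^\beta)(\alpha_n)>0$ if $\gamma_n=\alpha_n$, $(\phi_n^*/\dot B_n^\alpha)(\beta_n)>0$ if $\gamma_n=\beta_n$. Numerators: $p_n^\nu=\phi_n^\nu\pi_n^\nu$ is a polynomial of degree at most $n$, and $p_n^{\nu*}(z)=z^n\overline{p_n^\nu(1/\overline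 z)}$. Evaluating at $\infty$ a polynomial regarded as an element of the polynomials of degree $\le n$ (such as $p_n^\nu$, $p_n^{\nu*}$) means taking its coefficient of $z^n$. *)

theory Defs
  imports "HOL-Complex_Analysis.Complex_Analysis" "HOL-Probability.Probability_Measure"
begin

datatype xpoint = Pt complex | Infpt

datatype family = Alpha | Beta | Gamma

definition beta_point :: "complex \<Rightarrow> xpoint" where
  "beta_point a = (if a = 0 then Infpt else Pt (1 / cnj a))"

fun pole :: "(nat \<Rightarrow> complex) \<Rightarrow> (nat \<Rightarrow> xpoint) \<Rightarrow> family \<Rightarrow> nat \<Rightarrow> xpoint" where
  "pole \<alpha> \<gamma> Alpha j = Pt (\<alpha> j)"
| "pole \<alpha> \<gamma> Beta j = beta_point (\<alpha> j)"
| "pole \<alpha> \<gamma> Gamma j = \<gamma> j"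

definition admissible_poles :: "(nat \<Rightarrow> complex) \<Rightarrow> (nat \<Rightarrow> xpoint) \<Rightarrow> bool" where
  "admissible_poles \<alpha> \<gamma> \<longleftrightarrow>
     \<alpha> 0 = 0 \<and> (\<forall>j\<ge>1. cmod (\<alpha> j) < 1) \<and>
     (\<forall>j. \<gamma> j \<in> {Pt (\<alpha> j), beta_point (\<alpha> j)})"

definition sgm :: "complex \<Rightarrow> complex" where
  "sgm a = (if a = 0 then 1 else cnj a / of_real (cmod a))"

(* The index is an integer so that the value at -1 is the empty product as well. *)
definition varsigma :: "(nat \<Rightarrow> complex) \<Rightarrow> int \<Rightarrow> complex" where
  "varsigma \<alpha> k = (\<Prod>j=1..nat k. sgm (\<alpha> j))"

fun varpi :: "xpoint \<Rightarrow> complex \<Rightarrow> complex" where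
  "varpi (Pt w) z = 1 - cnj w * z"
| "varpi Infpt z = - z"

fun varpi_star :: "xpoint \<Rightarrow> complex \<Rightarrow> complex" where
  "varpi_star (Pt w) z = z - w"
| "varpi_star Infpt z = - 1"

definition zeta :: "(nat \<Rightarrow> complex) \<Rightarrow> (nat \<Rightarrow> xpoint) \<Rightarrow> family \<Rightarrow> nat \<Rightarrow> complex \<Rightarrow> complex" where
  "zeta \<alpha> \<gamma> \<nu> j z =
     sgm (\<alpha> j) * varpi_star (pole \<alpha> \<gamma> \<nu> j) z / varpi (pole \<alpha> \<gamma> \<nu> j) z"

definition pi_prod :: "(nat \<Rightarrow> complex) \<Rightarrow> (nat \<Rightarrow> xpoint) \<Rightarrow> family \<Rightarrow> nat \<Rightarrow> complex \<Rightarrow> complex" where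
  "pi_prod \<alpha> \<gamma> \<nu> n z = (\<Prod>j=1..n. varpi (pole \<alpha> \<gamma> \<nu> j) z)"

definition Bdot_alpha :: "(nat \<Rightarrow> complex) \<Rightarrow> (nat \<Rightarrow> xpoint) \<Rightarrow> nat \<Rightarrow> complex \<Rightarrow> complex" where
  "Bdot_alpha \<alpha> \<gamma> n z = (\<Prod>j\<in>{j\<in>{1..n}. \<gamma> j = Pt (\<alpha> j)}. zeta \<alpha> \<gamma> Alpha j z)"

definition Bdot_beta :: "(nat \<Rightarrow> complex) \<Rightarrow> (nat \<Rightarrow> xpoint) \<Rightarrow> nat \<Rightarrow> complex \<Rightarrow> complex" where
  "Bdot_beta \<alpha> \<gamma> n z = (\<Prod>j\<in>{j\<in>{1..n}. \<gamma> j = beta_point (\<alpha> j)}. zeta \<alpha> \<gamma> Beta j z)"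

fun Bl :: "(nat \<Rightarrow> complex) \<Rightarrow> (nat \<Rightarrow> xpoint) \<Rightarrow> family \<Rightarrow> nat \<Rightarrow> complex \<Rightarrow> complex" where
  "Bl \<alpha> \<gamma> Alpha n z = (\<Prod>j=1..n. zeta \<alpha> \<gamma> Alpha j z)"
| "Bl \<alpha> \<gamma> Beta n z = (\<Prod>j=1..n. zeta \<alpha> \<gamma> Beta j z)"
| "Bl \<alpha> \<gamma> Gamma n z =
     (if n = 0 then 1
      else if \<gamma> n = Pt (\<alpha> n) then Bdot_alpha \<alpha> \<gamma> n z
      else Bdot_beta \<alpha> \<gamma> n z)"

definition Lspace :: "(nat \<Rightarrow> complex) \<Rightarrow> (nat \<Rightarrow> xpoint) \<Rightarrow> family \<Rightarrow> nat \<Rightarrow> (complex \<Rightarrow> complex) set" where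
  "Lspace \<alpha> \<gamma> \<nu> n = {f. \<exists>c. f = (\<lambda>z. \<Sum>k\<le>n. c k * Bl \<alpha> \<gamma> \<nu> k z)}"

(* The product by which the substar conjugate is multiplied to form the reciprocal.
   For Gamma it differs from Bl. *)
fun Bfull :: "(nat \<Rightarrow> complex) \<Rightarrow> (nat \<Rightarrow> xpoint) \<Rightarrow> family \<Rightarrow> nat \<Rightarrow> complex \<Rightarrow> complex" where
  "Bfull \<alpha> \<gamma> Alpha n z = Bl \<alpha> \<gamma> Alpha n z"
| "Bfull \<alpha> \<gamma> Beta n z = Bl \<alpha> \<gamma> Beta n z"
| "Bfull \<alpha> \<gamma> Gamma n z = Bdot_alpha \<alpha> \<gamma> n z * Bdot_beta \<alpha> \<gamma> n z"

definition substar :: "(complex \<Rightarrow> complex) \<Rightarrow> complex \<Rightarrow> complex" where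
  "substar f z = cnj (f (1 / cnj z))"

(* The product is a rational function, but the pointwise formula has removable
   singularities: at the reflections of the poles of f and at z = 0, where
   1 / cnj z is the HOL value 0. They are removed, so that the reciprocal has its
   correct value at every point that is not a pole. *)
definition recip ::
  "(nat \<Rightarrow> complex) \<Rightarrow> (nat \<Rightarrow> xpoint) \<Rightarrow> family \<Rightarrow> nat \<Rightarrow> (complex \<Rightarrow> complex) \<Rightarrow> complex \<Rightarrow> complex" where
  "recip \<alpha> \<gamma> \<nu> n f = remove_sings (\<lambda>z. Bfull \<alpha> \<gamma> \<nu> n z * substar f z)"

(* The value of a rational function at a point of the extended plane is taken as a
   limit, since the point may be infinity or a removable singularity of a quotient. *)
fun positive_at :: "(complex \<Rightarrow> complex) \<Rightarrow> xpoint \<Rightarrow> bool" where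
  "positive_at f (Pt w) \<longleftrightarrow> (\<exists>r>0. (f \<longlongrightarrow> complex_of_real r) (at w))"
| "positive_at f Infpt \<longleftrightarrow> (\<exists>r>0. (f \<longlongrightarrow> complex_of_real r) at_infinity)"

fun normalized ::
  "(nat \<Rightarrow> complex) \<Rightarrow> (nat \<Rightarrow> xpoint) \<Rightarrow> family \<Rightarrow> nat \<Rightarrow> (complex \<Rightarrow> complex) \<Rightarrow> bool" where
  "normalized \<alpha> \<gamma> Alpha n f \<longleftrightarrow> positive_at (recip \<alpha> \<gamma> Alpha n f) (Pt (\<alpha> n))"
| "normalized \<alpha> \<gamma> Beta n f \<longleftrightarrow> positive_at (recip \<alpha> \<gamma> Beta n f) (beta_point (\<alpha> n))"
| "normalized \<alpha> \<gamma> Gamma n f \<longleftrightarrow>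
     (if \<gamma> n = Pt (\<alpha> n)
      then positive_at (\<lambda>z. recip \<alpha> \<gamma> Gamma n f z / Bdot_beta \<alpha> \<gamma> n z) (Pt (\<alpha> n))
      else positive_at (\<lambda>z. recip \<alpha> \<gamma> Gamma n f z / Bdot_alpha \<alpha> \<gamma> n z) (beta_point (\<alpha> n)))"

definition circle_borel :: "complex measure" where
  "circle_borel = restrict_space borel (sphere 0 1)"

definition arc_length :: "complex measure" where
  "arc_length = distr (restrict_space lborel {0..<2 * pi}) circle_borel cis"

(* "Positive a.e." is read as: every Borel set of positive arc length has positive
   measure. Equivalently, the absolutely continuous part of the measure has a density
   that is positive almost everywhere with respect to arc length. *)
definition positive_ae_prob :: "complex measure \<Rightarrow> bool" where
  "positive_ae_prob \<mu> \<longleftrightarrow>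
     sets \<mu> = sets circle_borel \<and> prob_space \<mu> \<and> absolutely_continuous \<mu> arc_length"

definition ip :: "complex measure \<Rightarrow> (complex \<Rightarrow> complex) \<Rightarrow> (complex \<Rightarrow> complex) \<Rightarrow> complex" where
  "ip \<mu> f g = (LINT z|\<mu>. cnj (f z) * g z)"

definition orthonormal_functions ::
  "complex measure \<Rightarrow> (nat \<Rightarrow> complex) \<Rightarrow> (nat \<Rightarrow> xpoint) \<Rightarrow> family \<Rightarrow> (nat \<Rightarrow> complex \<Rightarrow> complex) \<Rightarrow> bool" where
  "orthonormal_functions \<mu> \<alpha> \<gamma> \<nu> \<phi> \<longleftrightarrow>
     \<phi> 0 = (\<lambda>_. 1) \<and>
     (\<forall>n\<ge>1. \<phi> n \<in> Lspace \<alpha> \<gamma> \<nu> n - Lspace \<alpha> \<gamma> \<nu> (n - 1) \<and>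
            (\<forall>g \<in> Lspace \<alpha> \<gamma> \<nu> (n - 1). ip \<mu> g (\<phi> n) = 0) \<and>
            ip \<mu> (\<phi> n) (\<phi> n) = 1 \<and>
            normalized \<alpha> \<gamma> \<nu> n (\<phi> n))"

definition numer ::
  "(nat \<Rightarrow> complex) \<Rightarrow> (nat \<Rightarrow> xpoint) \<Rightarrow> family \<Rightarrow> nat \<Rightarrow> (complex \<Rightarrow> complex) \<Rightarrow> complex poly" where
  "numer \<alpha> \<gamma> \<nu> n f =
     (THE p. \<forall>z. pi_prod \<alpha> \<gamma> \<nu> n z \<noteq> 0 \<longrightarrow> poly p z = f z * pi_prod \<alpha> \<gamma> \<nu> n z)"

definition rev_poly :: "nat \<Rightarrow> complex poly \<Rightarrow> complex poly" where
  "rev_poly n p = (\<Sum>k\<le>n. monom (cnj (coeff p (n - k))) k)"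

fun peval :: "nat \<Rightarrow> complex poly \<Rightarrow> xpoint \<Rightarrow> complex" where
  "peval n p (Pt w) = poly p w"
| "peval n p Infpt = coeff p n"

definition eta_par ::
  "(nat \<Rightarrow> complex) \<Rightarrow> (nat \<Rightarrow> xpoint) \<Rightarrow> family \<Rightarrow> (nat \<Rightarrow> complex \<Rightarrow> complex) \<Rightarrow> nat \<Rightarrow> complex" where
  "eta_par \<alpha> \<gamma> \<nu> \<phi> n =
     (let v = peval (n - 1) (rev_poly (n - 1) (numer \<alpha> \<gamma> \<nu> (n - 1) (\<phi> (n - 1)))) (pole \<alpha> \<gamma> \<nu> (n - 1))
      in cnj (varsigma \<alpha> (int n - 2)) * (cnj v / v))"

definition lambda_par ::
  "(nat \<Rightarrow> complex) \<Rightarrow> (nat \<Rightarrow> xpoint) \<Rightarrow> family \<Rightarrow> (nat \<Rightarrow> complex \<Rightarrow> complex) \<Rightarrow> nat \<Rightarrow> complex" where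
  "lambda_par \<alpha> \<gamma> \<nu> \<phi> n =
     (let p = numer \<alpha> \<gamma> \<nu> n (\<phi> n); w = pole \<alpha> \<gamma> \<nu> (n - 1)
      in eta_par \<alpha> \<gamma> \<nu> \<phi> n * (peval n p w / cnj (peval n (rev_poly n p) w)))"

definition mat2 :: "complex \<Rightarrow> complex \<Rightarrow> complex \<Rightarrow> complex \<Rightarrow> complex^2^2" where
  "mat2 a b c d = vector [vector [a, b], vector [c, d]]"

definition H_mat :: "complex \<Rightarrow> complex \<Rightarrow> complex \<Rightarrow> complex^2^2" where
  "H_mat e \<eta>1 \<eta>2 = mat e ** mat2 \<eta>1 0 0 \<eta>2"

definition recursion_rhs ::
  "(nat \<Rightarrow> complex) \<Rightarrow> (nat \<Rightarrow> xpoint) \<Rightarrow> family \<Rightarrow> (nat \<Rightarrow> complex \<Rightarrow> complex) \<Rightarrow> nat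
     \<Rightarrow> complex^2^2 \<Rightarrow> complex \<Rightarrow> complex^2" where
  "recursion_rhs \<alpha> \<gamma> \<nu> \<phi> n H z =
     (varpi (pole \<alpha> \<gamma> \<nu> (n - 1)) z / varpi (pole \<alpha> \<gamma> \<nu> n) z) *s
       ((H ** mat2 1 (lambda_par \<alpha> \<gamma> \<nu> \<phi> n) (cnj (lambda_par \<alpha> \<gamma> \<nu> \<phi> n)) 1
           ** mat2 (zeta \<alpha> \<gamma> \<nu> (n - 1) z) 0 0 1)
        *v vector [\<phi> (n - 1) z, recip \<alpha> \<gamma> \<nu> (n - 1) (\<phi> (n - 1)) z])"

lemma poly_rev_poly:
  assumes "degree p \<le> n" "z \<noteq> 0"
  shows "poly (rev_poly n p) z = z ^ n * cnj (poly p (1 / cnj z))"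
proof -
  have "poly (rev_poly n p) z = (\<Sum>k\<le>n. cnj (coeff p (n - k)) * z ^ k)"
    by (simp add: rev_poly_def poly_sum poly_monom)
  also have "\<dots> = (\<Sum>k\<le>n. cnj (coeff p k) * z ^ (n - k))"
    by (rule sum.reindex_bij_witness[of _ "\<lambda>k. n - k" "\<lambda>k. n - k"]) auto
  also have "\<dots> = (\<Sum>k\<le>n. z ^ n * (cnj (coeff p k) * (1 / z) ^ k))"
    using assms(2) by (intro sum.cong) (auto simp: power_diff power_divide field_simps)
  also have "\<dots> = z ^ n * cnj (\<Sum>k\<le>n. coeff p k * (1 / cnj z) ^ k)"
    by (simp add: sum_distrib_left)
  also have "(\<Sum>k\<le>n. coeff p k * (1 / cnj z) ^ k) = poly p (1 / cnj z)"
    unfolding poly_altdef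
    using assms(1) by (intro sum.mono_neutral_right) (auto simp: coeff_eq_0)
  finally show ?thesis .
qed

fun varpi_poly :: "xpoint \<Rightarrow> complex poly" where
  "varpi_poly (Pt w) = [:1, - cnj w:]"
| "varpi_poly Infpt = [:0, - 1:]"

fun varpi_star_poly :: "xpoint \<Rightarrow> complex poly" where
  "varpi_star_poly (Pt w) = [:- w, 1:]"
| "varpi_star_poly Infpt = [:- 1:]"

lemma poly_varpi_poly: "poly (varpi_poly w) z = varpi w z"
  by (cases w) auto

lemma poly_varpi_star_poly: "poly (varpi_star_poly w) z = varpi_star w z"
  by (cases w) auto

lemma degree_varpi_poly: "degree (varpi_poly w) \<le> 1"
  by (cases w) auto

lemma degree_varpi_star_poly: "degree (varpi_star_poly w) \<le> 1"
  by (cases w) auto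

lemma varpi_poly_nonzero: "varpi_poly w \<noteq> 0"
  by (cases w) auto

lemma prod_zeta_poly:
  assumes "J \<subseteq> {1..n}"
  obtains p where "degree p \<le> n"
    "\<And>z. pi_prod \<alpha> \<gamma> \<nu> n z \<noteq> 0 \<Longrightarrow>
       poly p z = (\<Prod>j\<in>J. zeta \<alpha> \<gamma> \<nu> j z) * pi_prod \<alpha> \<gamma> \<nu> n z"
proof
  let ?q = "\<lambda>j. if j \<in> J then smult (sgm (\<alpha> j)) (varpi_star_poly (pole \<alpha> \<gamma> \<nu> j))
                 else varpi_poly (pole \<alpha> \<gamma> \<nu> j)"
  have "degree (\<Prod>j=1..n. ?q j) \<le> sum (degree \<circ> ?q) {1..n}"
    by (rule degree_prod_sum_le) auto
  also have "\<dots> \<le> (\<Sum>j=1..n. 1)"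
    using degree_varpi_poly degree_varpi_star_poly
    by (intro sum_mono) (auto intro: order_trans[OF degree_smult_le])
  finally show "degree (\<Prod>j=1..n. ?q j) \<le> n" by simp
  fix z assume "pi_prod \<alpha> \<gamma> \<nu> n z \<noteq> 0"
  hence nz: "varpi (pole \<alpha> \<gamma> \<nu> j) z \<noteq> 0" if "j \<in> {1..n}" for j
    using that unfolding pi_prod_def by (auto simp: prod_zero_iff)
  have "(\<Prod>j\<in>J. zeta \<alpha> \<gamma> \<nu> j z) = (\<Prod>j=1..n. if j \<in> J then zeta \<alpha> \<gamma> \<nu> j z else 1)"
    using assms by (simp add: prod.If_cases Int_absorb1)
  hence "(\<Prod>j\<in>J. zeta \<alpha> \<gamma> \<nu> j z) * pi_prod \<alpha> \<gamma> \<nu> n z =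
        (\<Prod>j=1..n. (if j \<in> J then zeta \<alpha> \<gamma> \<nu> j z else 1) * varpi (pole \<alpha> \<gamma> \<nu> j) z)"
    by (simp add: pi_prod_def prod.distrib)
  also have "\<dots> = (\<Prod>j=1..n. poly (?q j) z)"
    using nz by (intro prod.cong) (auto simp: zeta_def poly_varpi_poly poly_varpi_star_poly)
  finally show "poly (\<Prod>j=1..n. ?q j) z = (\<Prod>j\<in>J. zeta \<alpha> \<gamma> \<nu> j z) * pi_prod \<alpha> \<gamma> \<nu> n z"
    by (simp add: poly_prod)
qed

lemma Bl_as_prod_zeta:
  assumes "admissible_poles \<alpha> \<gamma>" "k \<le> n"
  obtains J where "J \<subseteq> {1..n}" "\<And>z. Bl \<alpha> \<gamma> \<nu> k z = (\<Prod>j\<in>J. zeta \<alpha> \<gamma> \<nu> j z)"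
proof (cases \<nu>)
  case Gamma
  consider "k = 0" | "k > 0" "\<gamma> k = Pt (\<alpha> k)" | "k > 0" "\<gamma> k \<noteq> Pt (\<alpha> k)" by auto
  thus ?thesis
  proof cases
    case 1
    thus ?thesis using that[of "{}"] Gamma by auto
  next
    case 2
    show ?thesis
    proof (rule that[of "{j\<in>{1..k}. \<gamma> j = Pt (\<alpha> j)}"])
      show "{j\<in>{1..k}. \<gamma> j = Pt (\<alpha> j)} \<subseteq> {1..n}" using assms(2) by auto
    qed (use Gamma 2 in \<open>auto simp: Bdot_alpha_def zeta_def intro!: prod.cong\<close>)
  next
    case 3
    show ?thesis
    proof (rule that[of "{j\<in>{1..k}. \<gamma> j = beta_point (\<alpha> j)}"])
      show "{j\<in>{1..k}. \<gamma> j = beta_point (\<alpha> j)} \<subseteq> {1..n}" using assms(2) by auto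
    qed (use Gamma 3 in \<open>auto simp: Bdot_beta_def zeta_def intro!: prod.cong\<close>)
  qed
qed (use that[of "{1..k}"] assms(2) in auto)

text \<open>The numerator in the definition above exists, is unique, and has degree at most n.\<close>

lemma numer_unique:
  assumes p: "\<And>z. pi_prod \<alpha> \<gamma> \<nu> n z \<noteq> 0 \<Longrightarrow> poly p z = f z * pi_prod \<alpha> \<gamma> \<nu> n z"
  shows "numer \<alpha> \<gamma> \<nu> n f = p"
  unfolding numer_def
proof (rule the_equality)
  fix q assume q: "\<forall>z. pi_prod \<alpha> \<gamma> \<nu> n z \<noteq> 0 \<longrightarrow> poly q z = f z * pi_prod \<alpha> \<gamma> \<nu> n z"
  define r where "r = (\<Prod>j=1..n. varpi_poly (pole \<alpha> \<gamma> \<nu> j))"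
  have r: "poly r z = pi_prod \<alpha> \<gamma> \<nu> n z" for z
    by (simp add: r_def pi_prod_def poly_prod poly_varpi_poly)
  have "poly ((q - p) * r) z = 0" for z
    using p[of z] q r[of z] by (cases "pi_prod \<alpha> \<gamma> \<nu> n z = 0") auto
  hence "(q - p) * r = 0" by (simp add: poly_eq_poly_eq_iff[symmetric] fun_eq_iff)
  moreover have "r \<noteq> 0" by (simp add: r_def varpi_poly_nonzero)
  ultimately show "q = p" by simp
qed (use p in blast)

lemma numer_properties:
  assumes "admissible_poles \<alpha> \<gamma>" "f \<in> Lspace \<alpha> \<gamma> \<nu> n"
  shows "degree (numer \<alpha> \<gamma> \<nu> n f) \<le> n"
    and "\<And>z. pi_prod \<alpha> \<gamma> \<nu> n z \<noteq> 0 \<Longrightarrow>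
           poly (numer \<alpha> \<gamma> \<nu> n f) z = f z * pi_prod \<alpha> \<gamma> \<nu> n z"
proof -
  obtain c where f: "f = (\<lambda>z. \<Sum>k\<le>n. c k * Bl \<alpha> \<gamma> \<nu> k z)"
    using assms(2) by (auto simp: Lspace_def)
  have "\<exists>p. degree p \<le> n \<and> (\<forall>z. pi_prod \<alpha> \<gamma> \<nu> n z \<noteq> 0 \<longrightarrow>
             poly p z = Bl \<alpha> \<gamma> \<nu> k z * pi_prod \<alpha> \<gamma> \<nu> n z)" if k: "k \<le> n" for k
  proof -
    obtain J where J: "J \<subseteq> {1..n}" "\<And>z. Bl \<alpha> \<gamma> \<nu> k z = (\<Prod>j\<in>J. zeta \<alpha> \<gamma> \<nu> j z)"
      using Bl_as_prod_zeta[OF assms(1) k] by blast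
    show ?thesis using prod_zeta_poly[OF J(1), of \<alpha> \<gamma> \<nu>] J(2) by metis
  qed
  then obtain P where P: "\<And>k. k \<le> n \<Longrightarrow> degree (P k) \<le> n"
    "\<And>k z. k \<le> n \<Longrightarrow> pi_prod \<alpha> \<gamma> \<nu> n z \<noteq> 0 \<Longrightarrow>
       poly (P k) z = Bl \<alpha> \<gamma> \<nu> k z * pi_prod \<alpha> \<gamma> \<nu> n z"
    by metis
  define p where "p = (\<Sum>k\<le>n. smult (c k) (P k))"
  have p: "poly p z = f z * pi_prod \<alpha> \<gamma> \<nu> n z" if "pi_prod \<alpha> \<gamma> \<nu> n z \<noteq> 0" for z
    using P(2) that by (auto simp: p_def f poly_sum sum_distrib_right intro!: sum.cong)
  have deg: "degree p \<le> n"
    unfolding p_def using P(1) by (intro degree_sum_le) (auto intro: order_trans[OF degree_smult_le])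
  have eq: "numer \<alpha> \<gamma> \<nu> n f = p" using p by (rule numer_unique)
  show "degree (numer \<alpha> \<gamma> \<nu> n f) \<le> n" using deg eq by simp
  show "\<And>z. pi_prod \<alpha> \<gamma> \<nu> n z \<noteq> 0 \<Longrightarrow>
           poly (numer \<alpha> \<gamma> \<nu> n f) z = f z * pi_prod \<alpha> \<gamma> \<nu> n z"
    using p eq by simp
qed

end

theory Submission
  imports Defs
begin

text \<open>
  Write \<open>\<phi>\<^sub>n = p\<^sub>n / \<pi>\<^sub>n\<close> and \<open>q\<^sub>n\<close> for the reversal \<open>p\<^sub>n\<^sup>*\<close> of \<open>p\<^sub>n\<close>; away from the zeros of
  \<open>\<pi>\<^sub>n\<close> the reciprocal of \<open>\<phi>\<^sub>n\<close> is \<open>\<varsigma>\<^sub>n q\<^sub>n / \<pi>\<^sub>n\<close> (\<open>recip_rational\<close>). The recursion is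
  therefore an identity between polynomials, and its second row is the reversal of the first.
  The three choices of \<open>\<nu>\<close> are treated at once: what the proof of this identity needs of the
  poles is that they lie off the circle.

  Put \<open>n = m + 1\<close>. The heart of the proof is a dimension count with respect to the inner product
  \<open>\<langle>r, s\<rangle> = \<integral> cnj r s / |\<pi>\<^sub>m|\<^sup>2 d\<mu>\<close> on polynomials. On the circle \<open>cnj \<varpi>\<close> is
  \<open>\<varpi>\<^sup>* / z\<close>, and with this rule the orthogonality relations of \<open>\<phi>\<^sub>m\<close> and \<open>\<phi>\<^sub>m\<^sub>+\<^sub>1\<close> turn into
  the same statement: each of \<open>p\<^sub>m\<^sub>+\<^sub>1\<close>, \<open>\<varpi>\<^sub>m\<^sup>* p\<^sub>m\<close> and \<open>\<varpi>\<^sub>m q\<^sub>m\<close> has degree at most \<open>m + 1\<close>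
  and is orthogonal to \<open>z, ..., z\<^sup>m\<close>. Such polynomials form a plane, which the last two
  span since \<open>q\<^sub>m\<close> does not vanish at \<open>\<nu>\<^sub>m\<close> (\<open>shift_orthogonal_spanned\<close>). Hence
  \<open>p\<^sub>m\<^sub>+\<^sub>1 = A \<varpi>\<^sub>m\<^sup>* p\<^sub>m + B \<varpi>\<^sub>m q\<^sub>m\<close> (\<open>num_Suc_recursion\<close>).

  Evaluating this identity and its reversal at \<open>\<nu>\<^sub>m\<close>, where \<open>\<varpi>\<^sub>m\<^sup>*\<close> vanishes (for
  \<open>\<nu>\<^sub>m = \<infinity>\<close>: has no linear coefficient), expresses \<open>B / A\<close>
  by \<open>p\<^sub>m\<^sub>+\<^sub>1(\<nu>\<^sub>m)\<close> and \<open>q\<^sub>m\<^sub>+\<^sub>1(\<nu>\<^sub>m)\<close>, which is the formula for \<open>\<lambda>\<close>, and shows that regularity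
  means \<open>A \<noteq> 0\<close>. Then \<open>e = |A|\<close>, the phase of \<open>A\<close> gives \<open>\<eta>1\<close>, and that \<open>e\<close> is real forces
  the stated relation between \<open>\<eta>2\<close> and \<open>\<eta>1\<close>. Replacing \<open>\<eta>1\<close> by another unimodular \<open>\<eta>\<close> rotates \<open>\<phi>\<^sub>n\<close>
  by \<open>\<eta> / \<eta>1\<close> and so destroys the normalization (\<open>normalized_rotate\<close>).

  For \<open>\<nu> = \<alpha>, \<beta>\<close> regularity is automatic: if \<open>A = 0\<close>, then testing
  \<open>\<phi>\<^sub>m\<^sub>+\<^sub>1\<close> against \<open>q\<^sub>m / \<pi>\<^sub>m\<close> makes a weighted mean of
  \<open>(1 - a cnj z) (1 - cnj c z)\<close> with \<open>|a|, |c| < 1\<close> vanish, which a Schwarz-Pick estimate excludes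
  (\<open>moebius_mean_nonzero\<close>).
\<close>

section \<open>Reversal of polynomials and values at extended points\<close>

lemma coeff_rev_poly: "coeff (rev_poly n p) k = (if k \<le> n then cnj (coeff p (n - k)) else 0)"
  by (simp add: rev_poly_def coeff_sum if_distrib[of "\<lambda>x. x = _"] eq_commute)

lemma degree_rev_poly: "degree (rev_poly n p) \<le> n"
  by (rule degree_le) (simp add: coeff_rev_poly)

lemma rev_poly_rev_poly: "degree p \<le> n \<Longrightarrow> rev_poly n (rev_poly n p) = p"
  by (rule poly_eqI) (auto simp: coeff_rev_poly coeff_eq_0)

lemma rev_poly_add: "rev_poly n (p + q) = rev_poly n p + rev_poly n q"
  by (rule poly_eqI) (simp add: coeff_rev_poly)

lemma rev_poly_smult: "rev_poly n (smult c p) = smult (cnj c) (rev_poly n p)"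
  by (rule poly_eqI) (simp add: coeff_rev_poly)

lemma varpi_via_star: "z \<noteq> 0 \<Longrightarrow> z * cnj (varpi_star w (1 / cnj z)) = varpi w z"
  by (cases w) (auto simp: field_simps)

lemma varpi_star_via_varpi: "z \<noteq> 0 \<Longrightarrow> z * cnj (varpi w (1 / cnj z)) = varpi_star w z"
  by (cases w) (auto simp: field_simps)

lemma poly_eq_off_zero:
  fixes p q :: "complex poly"
  assumes "\<And>z. z \<noteq> 0 \<Longrightarrow> poly p z = poly q z"
  shows "p = q"
proof -
  have "poly ([:0, 1:] * p) z = poly ([:0, 1:] * q) z" for z
    using assms by (cases "z = 0") auto
  hence "[:0, 1:] * p = [:0, 1:] * q" by (simp only: poly_eq_poly_eq_iff[symmetric] fun_eq_iff) auto
  thus ?thesis by simp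
qed

lemma degree_varpi_star_mult: "degree t \<le> n \<Longrightarrow> degree (varpi_star_poly w * t) \<le> Suc n"
  using degree_mult_le[of "varpi_star_poly w" t] degree_varpi_star_poly[of w] by linarith

lemma degree_varpi_mult: "degree t \<le> n \<Longrightarrow> degree (varpi_poly w * t) \<le> Suc n"
  using degree_mult_le[of "varpi_poly w" t] degree_varpi_poly[of w] by linarith

text \<open>Reversal exchanges the two kinds of factors, so it interchanges the two summands of the recursion.\<close>

lemma rev_poly_varpi_star:
  assumes "degree t \<le> n"
  shows "rev_poly (Suc n) (varpi_star_poly w * t) = varpi_poly w * rev_poly n t"
proof (rule poly_eq_off_zero)
  fix z :: complex assume z: "z \<noteq> 0"
  show "poly (rev_poly (Suc n) (varpi_star_poly w * t)) z = poly (varpi_poly w * rev_poly n t) z"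
    using varpi_via_star[OF z, of w, symmetric]
    by (simp add: poly_rev_poly[OF degree_varpi_star_mult[OF assms] z] poly_rev_poly[OF assms z]
        poly_varpi_poly poly_varpi_star_poly)
qed

lemma rev_poly_varpi:
  assumes "degree t \<le> n"
  shows "rev_poly (Suc n) (varpi_poly w * t) = varpi_star_poly w * rev_poly n t"
proof (rule poly_eq_off_zero)
  fix z :: complex assume z: "z \<noteq> 0"
  show "poly (rev_poly (Suc n) (varpi_poly w * t)) z = poly (varpi_star_poly w * rev_poly n t) z"
    using varpi_star_via_varpi[OF z, of w, symmetric]
    by (simp add: poly_rev_poly[OF degree_varpi_mult[OF assms] z] poly_rev_poly[OF assms z]
        poly_varpi_poly poly_varpi_star_poly)
qed

lemma peval_add: "peval n (p + q) w = peval n p w + peval n q w"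
  by (cases w) auto

lemma peval_smult: "peval n (smult c p) w = c * peval n p w"
  by (cases w) auto

text \<open>This is \<open>\<varpi>\<close> of the pole \<open>w\<close>, evaluated at \<open>w\<close> itself; at infinity it is the leading coefficient of \<open>- z\<close>.\<close>

definition diag_value :: "xpoint \<Rightarrow> complex" where
  "diag_value w = (case w of Pt a \<Rightarrow> 1 - cnj a * a | Infpt \<Rightarrow> - 1)"

lemma cnj_diag_value: "cnj (diag_value w) = diag_value w"
  by (cases w) (auto simp: diag_value_def)

lemma peval_varpi_mult: "degree t \<le> n \<Longrightarrow> peval (Suc n) (varpi_poly w * t) w = diag_value w * peval n t w"
  by (cases w) (auto simp: diag_value_def algebra_simps)

lemma peval_varpi_star_mult: "degree t \<le> n \<Longrightarrow> peval (Suc n) (varpi_star_poly w * t) w = 0"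
  by (cases w) (auto simp: coeff_eq_0)

text \<open>Factor theorem on the extended plane. Vanishing at infinity means that the degree drops, and the
  factor \<open>\<varpi>\<^sup>* = - 1\<close> then records exactly this.\<close>

lemma varpi_star_dvd:
  assumes "degree p \<le> n" "peval n p w = 0"
  obtains t where "p = varpi_star_poly w * t" "t = 0 \<or> degree t < n"
proof (cases w)
  case (Pt a)
  with assms obtain t where t: "p = [:- a, 1:] * t" by (auto simp: poly_eq_0_iff_dvd dvd_def)
  have "t = 0 \<or> degree t < n"
  proof (cases "t = 0")
    case False
    hence "degree p = Suc (degree t)" unfolding t by (subst degree_mult_eq) auto
    thus ?thesis using assms(1) by simp
  qed auto
  thus ?thesis using that t Pt by auto
next
  case Infpt
  have "- p = 0 \<or> degree (- p) < n"
    using assms Infpt by (metis coeff_minus degree_minus le_neq_implies_less leading_coeff_0_iff minus_zero neg_equal_0_iff_equal peval.simps(2))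
  thus ?thesis using that[of "- p"] Infpt by auto
qed

text \<open>The zero of \<open>\<varpi>\<close> is the reflection of \<open>w\<close> in the circle, hence divisibility is tested on the reversal.
  This covers \<open>w = 0\<close>, where the zero lies at infinity.\<close>

lemma varpi_dvd:
  assumes "degree p \<le> n" "peval n (rev_poly n p) w = 0"
  obtains t where "p = varpi_poly w * t" "t = 0 \<or> degree t < n"
proof -
  obtain t where t: "rev_poly n p = varpi_star_poly w * t" "t = 0 \<or> degree t < n"
    using varpi_star_dvd[OF degree_rev_poly assms(2)] .
  show ?thesis
  proof (cases "t = 0")
    case True
    hence "rev_poly n p = 0" by (simp add: t(1))
    hence "rev_poly n (rev_poly n p) = 0" by (simp add: rev_poly_def)
    thus ?thesis using that[of 0] rev_poly_rev_poly[OF assms(1)] by simp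
  next
    case False
    then obtain m where m: "n = Suc m" "degree t \<le> m" using t(2) by (cases n) auto
    have "p = rev_poly n (varpi_star_poly w * t)" using t(1) rev_poly_rev_poly[OF assms(1)] by simp
    also have "\<dots> = varpi_poly w * rev_poly m t" using rev_poly_varpi_star m by simp
    finally show ?thesis using that[of "rev_poly m t"] degree_rev_poly[of m t] m by simp
  qed
qed

section \<open>Pole factors\<close>

lemma admissible_pole:
  assumes "admissible_poles \<alpha> \<gamma>"
  shows "cmod (\<alpha> j) < 1" "pole \<alpha> \<gamma> \<nu> j \<in> {Pt (\<alpha> j), beta_point (\<alpha> j)}"
proof -
  show "cmod (\<alpha> j) < 1" using assms unfolding admissible_poles_def
    by (cases "j = 0") auto
  show "pole \<alpha> \<gamma> \<nu> j \<in> {Pt (\<alpha> j), beta_point (\<alpha> j)}"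
    using assms unfolding admissible_poles_def by (cases \<nu>) auto
qed

definition off_circle :: "xpoint \<Rightarrow> bool" where
  "off_circle w \<longleftrightarrow> (\<forall>a. w = Pt a \<longrightarrow> cmod a \<noteq> 1)"

lemma off_circle_pole:
  assumes "admissible_poles \<alpha> \<gamma>"
  shows "off_circle (pole \<alpha> \<gamma> \<nu> j)"
  using admissible_pole(1)[OF assms, of j] admissible_pole(2)[OF assms, of \<nu> j]
  by (auto simp: off_circle_def beta_point_def norm_divide split: if_splits)

lemma mult_cnj_eq_1_iff: "a * cnj a = 1 \<longleftrightarrow> cmod a = 1"
proof -
  have "a * cnj a = 1 \<longleftrightarrow> complex_of_real ((cmod a)\<^sup>2) = of_real 1"
    by (simp only: complex_norm_square of_real_1)
  also have "\<dots> \<longleftrightarrow> (cmod a)\<^sup>2 = 1" by (rule of_real_eq_iff)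
  also have "\<dots> \<longleftrightarrow> cmod a = 1" using norm_ge_zero[of a] by (simp add: power2_eq_1_iff del: norm_ge_zero)
  finally show ?thesis .
qed

lemma diag_value_nonzero:
  assumes "off_circle w"
  shows "diag_value w \<noteq> 0"
proof (cases w)
  case (Pt a)
  have "a * cnj a \<noteq> 1"
    using assms Pt by (simp add: mult_cnj_eq_1_iff off_circle_def)
  thus ?thesis using Pt by (simp add: diag_value_def mult.commute)
qed (simp add: diag_value_def)

lemma varpi_nonzero_on_circle: "off_circle w \<Longrightarrow> cmod z = 1 \<Longrightarrow> varpi w z \<noteq> 0"
proof (cases w)
  case (Pt a)
  assume a: "off_circle w" "cmod z = 1"
  have "cmod (cnj a * z) \<noteq> 1" using a Pt by (simp add: off_circle_def norm_mult)
  thus ?thesis using Pt by (metis eq_iff_diff_eq_0 norm_one varpi.simps(1))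
qed auto

text \<open>Since \<open>cnj z = 1 / z\<close> on the circle, conjugation exchanges the two kinds of factors there; every
  comparison of orthogonality relations below rests on this.\<close>

lemma cnj_varpi_on_circle:
  assumes "cmod z = 1"
  shows "cnj (varpi w z) = cnj z * varpi_star w z"
proof -
  have "z * cnj z = 1" using assms by (simp add: mult_cnj_eq_1_iff)
  thus ?thesis by (cases w) (auto simp: algebra_simps)
qed

lemma cmod_sgm [simp]: "cmod (sgm a) = 1"
  by (simp add: sgm_def norm_divide)

lemma cmod_varsigma [simp]: "cmod (varsigma \<alpha> k) = 1"
  by (simp add: varsigma_def prod_norm[symmetric])

section \<open>Integration on the unit circle\<close>

lemma space_positive_ae: "positive_ae_prob \<mu> \<Longrightarrow> space \<mu> = sphere 0 1"
  unfolding positive_ae_prob_def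
  by (metis sets_eq_imp_space_eq circle_borel_def space_restrict_space space_borel inf_top.right_neutral)

lemma integrable_continuous_on_circle:
  fixes f :: "complex \<Rightarrow> 'b::{banach,second_countable_topology}"
  assumes \<mu>: "positive_ae_prob \<mu>" and f: "continuous_on (sphere 0 1) f"
  shows "integrable \<mu> f"
proof -
  interpret prob_space \<mu> using \<mu> by (simp add: positive_ae_prob_def)
  have "compact (f ` sphere 0 1)" using f by (intro compact_continuous_image) auto
  then obtain B where B: "\<And>z. z \<in> sphere 0 1 \<Longrightarrow> norm (f z) \<le> B"
    by (meson bounded_iff compact_imp_bounded imageI)
  have "f \<in> borel_measurable circle_borel"
    unfolding circle_borel_def by (rule borel_measurable_continuous_on_restrict[OF f])
  hence "f \<in> borel_measurable \<mu>"
    using \<mu> by (simp add: positive_ae_prob_def cong: measurable_cong_sets)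
  thus ?thesis
    using B by (intro integrable_const_bound[of _ B]) (auto simp: space_positive_ae[OF \<mu>])
qed

text \<open>A finite set carries no arc length, so its complement in the circle has positive measure. Positivity
  almost everywhere enters here, and makes the inner products below definite.\<close>

lemma infinite_circle_if_ae:
  assumes \<mu>: "positive_ae_prob \<mu>" and ae: "AE z in \<mu>. z \<in> Z"
  shows "infinite Z"
proof
  assume fin: "finite Z"
  have "sphere 0 1 - Z \<in> sets borel"
    using finite_imp_closed[OF fin] by (intro sets.Diff borel_closed) auto
  hence "sphere 0 1 - Z \<in> sets circle_borel"
    unfolding circle_borel_def sets_restrict_space by (intro image_eqI[of _ _ "sphere 0 1 - Z"]) auto
  moreover have "AE z in \<mu>. z \<notin> sphere 0 1 - Z" using ae by auto
  ultimately have "sphere 0 1 - Z \<in> null_sets \<mu>"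
    using \<mu> by (subst AE_iff_null_sets) (auto simp: positive_ae_prob_def)
  hence null: "sphere 0 1 - Z \<in> null_sets arc_length"
    using \<mu> by (auto simp: positive_ae_prob_def absolutely_continuous_def)
  let ?M = "restrict_space lborel {0..<2 * pi}"
  have cis: "cis \<in> measurable ?M circle_borel"
    unfolding circle_borel_def
    by (intro measurable_restrict_space2 measurable_restrict_space1)
       (auto intro!: borel_measurable_continuous_onI continuous_intros)
  have "emeasure ?M (cis -` (sphere 0 1 - Z) \<inter> space ?M) = 0"
    using null cis emeasure_distr[OF cis, of "sphere 0 1 - Z"]
    unfolding arc_length_def null_sets_def by auto
  hence "emeasure lborel (cis -` (sphere 0 1 - Z) \<inter> {0..<2 * pi}) = 0"
    by (subst (asm) emeasure_restrict_space) (auto simp: space_restrict_space)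
  moreover have "cis -` (sphere 0 1 - Z) \<inter> {0..<2 * pi} = {0..<2 * pi} - (cis -` Z \<inter> {0..<2 * pi})"
    by auto
  moreover have "finite (cis -` Z \<inter> {0..<2 * pi})"
  proof (rule finite_vimage_IntI[OF fin])
    have "Arg2pi (cis t) = t" if "t \<in> {0..<2 * pi}" for t
      by (rule Arg2pi_unique[of 1]) (use that in \<open>auto simp: cis_conv_exp\<close>)
    thus "inj_on cis {0..<2 * pi}" by (rule inj_on_inverseI)
  qed
  hence "emeasure lborel ({0..<2 * pi} - (cis -` Z \<inter> {0..<2 * pi})) = emeasure lborel {0..<2 * pi}"
    by (intro emeasure_Diff_null_set finite_imp_null_set_lborel) auto
  ultimately show False using pi_gt_zero by simp
qed

lemma zeros_of_null_integral:
  fixes g :: "complex \<Rightarrow> real"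
  assumes \<mu>: "positive_ae_prob \<mu>" and g: "continuous_on (sphere 0 1) g"
    and nonneg: "\<And>z. cmod z = 1 \<Longrightarrow> 0 \<le> g z" and "integral\<^sup>L \<mu> g = 0"
  shows "infinite {z. cmod z = 1 \<and> g z = 0}"
proof (rule infinite_circle_if_ae[OF \<mu>])
  have nn: "AE z in \<mu>. 0 \<le> g z"
    by (rule AE_I2) (simp add: space_positive_ae[OF \<mu>] nonneg)
  have "AE z in \<mu>. g z = 0"
    by (rule integral_nonneg_eq_0_iff_AE[OF integrable_continuous_on_circle[OF \<mu> g] nn, THEN iffD1, OF assms(4)])
  thus "AE z in \<mu>. z \<in> {z. cmod z = 1 \<and> g z = 0}"
    by (rule AE_mp) (auto simp: space_positive_ae[OF \<mu>] intro!: AE_I2)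
qed

text \<open>Here \<open>M\<close> stands for a total mass and \<open>m\<close> for a first moment on the circle. If the expression vanished,
  then \<open>M - a cnj m = cnj c (m - a M)\<close>. But
  \<open>|M - a cnj m|\<^sup>2 - |m - a M|\<^sup>2 = (1 - |a|\<^sup>2) (M\<^sup>2 - |m|\<^sup>2)\<close> is nonnegative (Schwarz-Pick) and \<open>|c| < 1\<close>, so both
  sides would be zero, which is impossible for \<open>|a| < 1\<close>.\<close>

lemma moebius_mean_nonzero:
  fixes a c m :: complex and M :: real
  assumes M: "M > 0" and m: "cmod m \<le> M" and a: "cmod a < 1" and c: "cmod c < 1"
  shows "(1 + a * cnj c) * of_real M - cnj c * m - a * cnj m \<noteq> 0"
proof
  let ?x = "of_real M - a * cnj m" and ?y = "m - a * of_real M"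
  assume 0: "(1 + a * cnj c) * of_real M - cnj c * m - a * cnj m = 0"
  have "?x - cnj c * ?y = (1 + a * cnj c) * of_real M - cnj c * m - a * cnj m"
    by (simp add: algebra_simps)
  hence x: "?x = cnj c * ?y" using 0 by (metis eq_iff_diff_eq_0)
  have "complex_of_real ((cmod ?x)\<^sup>2 - (cmod ?y)\<^sup>2) =
        of_real ((1 - (cmod a)\<^sup>2) * (M\<^sup>2 - (cmod m)\<^sup>2))"
    by (simp only: of_real_diff of_real_mult of_real_1 complex_norm_square)
       (simp add: algebra_simps power2_eq_square)
  hence "(cmod ?x)\<^sup>2 - (cmod ?y)\<^sup>2 = (1 - (cmod a)\<^sup>2) * (M\<^sup>2 - (cmod m)\<^sup>2)"
    by (simp only: of_real_eq_iff)
  moreover have "(1 - (cmod a)\<^sup>2) * (M\<^sup>2 - (cmod m)\<^sup>2) \<ge> 0"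
    using a power_mono[OF m norm_ge_zero, of 2] power_le_one[of "cmod a" 2]
    by (intro mult_nonneg_nonneg) auto
  ultimately have "(cmod ?y)\<^sup>2 \<le> (cmod ?x)\<^sup>2" by linarith
  hence ge: "cmod ?y \<le> cmod ?x" by (rule power2_le_imp_le) (rule norm_ge_zero)
  have norm_x: "cmod ?x = cmod c * cmod ?y" unfolding x norm_mult complex_mod_cnj ..
  have y: "?y = 0"
  proof (rule ccontr)
    assume "?y \<noteq> 0"
    hence "cmod ?y > 0" by (simp only: zero_less_norm_iff not_False_eq_True)
    hence "cmod c * cmod ?y < 1 * cmod ?y" using c by (rule mult_strict_right_mono[rotated])
    thus False using norm_x ge by linarith
  qed
  have "cmod ?x = 0" unfolding norm_x y by (simp only: norm_zero mult_zero_right)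
  hence "complex_of_real M = a * cnj m" by (simp only: norm_eq_zero eq_iff_diff_eq_0[symmetric])
  moreover have "m = a * of_real M" using y by (simp only: eq_iff_diff_eq_0[symmetric])
  ultimately have "M = cmod a * cmod m" "cmod m = cmod a * M"
    using M by (metis abs_of_pos complex_mod_cnj norm_mult norm_of_real)+
  moreover have "cmod a * cmod m \<le> 1 * cmod m" "cmod a * M < 1 * M"
    using a M by (intro mult_right_mono mult_strict_right_mono; simp)+
  ultimately show False by linarith
qed

text \<open>On the circle \<open>z cnj z = 1\<close> makes the product linear in \<open>z\<close> and \<open>cnj z\<close>, so that its mean depends on the
  weight only through total mass and first moment.\<close>

lemma moebius_average_nonzero:
  assumes \<mu>: "positive_ae_prob \<mu>" and g: "continuous_on (sphere 0 1) g"
    and nonneg: "\<And>z. cmod z = 1 \<Longrightarrow> 0 \<le> g z" and mass: "integral\<^sup>L \<mu> g > 0"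
    and a: "cmod a < 1" and c: "cmod c < 1"
  shows "(LINT z|\<mu>. complex_of_real (g z) * ((1 - a * cnj z) * (1 - cnj c * z))) \<noteq> 0"
proof -
  define M where "M = integral\<^sup>L \<mu> g"
  define m where "m = (LINT z|\<mu>. complex_of_real (g z) * z)"
  have ig: "integrable \<mu> (\<lambda>z. complex_of_real (g z))"
    and iz: "integrable \<mu> (\<lambda>z. complex_of_real (g z) * z)"
    by (intro integrable_continuous_on_circle[OF \<mu>] continuous_intros g)+
  have iz': "integrable \<mu> (\<lambda>z. cnj (complex_of_real (g z) * z))" using iz by (rule integrable_cnj)
  have lin: "(LINT z|\<mu>. p * u z - q * v z - r * x z) = p * (LINT z|\<mu>. u z) - q * (LINT z|\<mu>. v z) - r * (LINT z|\<mu>. x z)"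
    if "integrable \<mu> u" "integrable \<mu> v" "integrable \<mu> x" for p q r :: complex and u v x
    using that by simp
  have mc: "(LINT z|\<mu>. cnj (complex_of_real (g z) * z)) = cnj m"
    unfolding m_def by (rule Bochner_Integration.integral_cnj)
  have "cmod m \<le> (LINT z|\<mu>. cmod (complex_of_real (g z) * z))"
    unfolding m_def by (rule integral_norm_bound)
  also have "\<dots> = M" unfolding M_def
    using nonneg by (intro Bochner_Integration.integral_cong) (auto simp: norm_mult space_positive_ae[OF \<mu>])
  finally have mM: "cmod m \<le> M" .
  have "(LINT z|\<mu>. complex_of_real (g z) * ((1 - a * cnj z) * (1 - cnj c * z))) =
        (LINT z|\<mu>. (1 + a * cnj c) * complex_of_real (g z) - cnj c * (complex_of_real (g z) * z)
                  - a * cnj (complex_of_real (g z) * z))"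
  proof (rule Bochner_Integration.integral_cong[OF refl])
    fix z assume "z \<in> space \<mu>"
    hence zz: "z * cnj z = 1" by (simp add: mult_cnj_eq_1_iff space_positive_ae[OF \<mu>])
    have "(1 - a * cnj z) * (1 - cnj c * z) = 1 + a * cnj c * (z * cnj z) - cnj c * z - a * cnj z"
      by (simp add: algebra_simps)
    hence e: "(1 - a * cnj z) * (1 - cnj c * z) = (1 + a * cnj c) - cnj c * z - a * cnj z"
      unfolding zz by simp
    show "complex_of_real (g z) * ((1 - a * cnj z) * (1 - cnj c * z)) =
      (1 + a * cnj c) * complex_of_real (g z) - cnj c * (complex_of_real (g z) * z)
                  - a * cnj (complex_of_real (g z) * z)"
      unfolding e by (simp add: algebra_simps)
  qed
  also have "\<dots> = (1 + a * cnj c) * of_real M - cnj c * m - a * cnj m"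
    unfolding lin[OF ig iz iz'] mc by (simp add: m_def M_def)
  finally have eq: "(LINT z|\<mu>. complex_of_real (g z) * ((1 - a * cnj z) * (1 - cnj c * z))) =
    (1 + a * cnj c) * of_real M - cnj c * m - a * cnj m" .
  show ?thesis unfolding eq
    by (rule moebius_mean_nonzero[OF _ mM a c]) (use mass in \<open>simp add: M_def\<close>)
qed

section \<open>Reciprocals\<close>

text \<open>For \<open>Gamma\<close> every index belongs to exactly one of the two products, because no \<open>\<alpha>\<^sub>j\<close> equals its reflection.\<close>

lemma Bfull_eq_prod_zeta:
  assumes "admissible_poles \<alpha> \<gamma>"
  shows "Bfull \<alpha> \<gamma> \<nu> n z = (\<Prod>j=1..n. zeta \<alpha> \<gamma> \<nu> j z)"
proof (cases \<nu>)
  case Gamma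
  have ne: "Pt (\<alpha> j) \<noteq> beta_point (\<alpha> j)" for j
    using admissible_pole(1)[OF assms, of j] mult_cnj_eq_1_iff[of "\<alpha> j"]
    by (auto simp: beta_point_def field_simps)
  have un: "{1..n} = {j\<in>{1..n}. \<gamma> j = Pt (\<alpha> j)} \<union> {j\<in>{1..n}. \<gamma> j = beta_point (\<alpha> j)}"
    using admissible_pole(2)[OF assms, of Gamma] by auto
  have "(\<Prod>j=1..n. zeta \<alpha> \<gamma> Gamma j z) =
     (\<Prod>j\<in>{j\<in>{1..n}. \<gamma> j = Pt (\<alpha> j)}. zeta \<alpha> \<gamma> Gamma j z) *
     (\<Prod>j\<in>{j\<in>{1..n}. \<gamma> j = beta_point (\<alpha> j)}. zeta \<alpha> \<gamma> Gamma j z)"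
    by (subst un, rule prod.union_disjoint) (auto simp: ne[symmetric] ne)
  also have "\<dots> = Bdot_alpha \<alpha> \<gamma> n z * Bdot_beta \<alpha> \<gamma> n z"
    unfolding Bdot_alpha_def Bdot_beta_def
    by (intro arg_cong2[of _ _ _ _ "(*)"] prod.cong) (auto simp: zeta_def)
  finally show ?thesis using Gamma by simp
qed auto

lemma finite_zeros_pi_prod: "finite {z. pi_prod \<alpha> \<gamma> \<nu> n z = 0}"
proof -
  have "pi_prod \<alpha> \<gamma> \<nu> n z = poly (\<Prod>j=1..n. varpi_poly (pole \<alpha> \<gamma> \<nu> j)) z" for z
    by (simp add: pi_prod_def poly_prod poly_varpi_poly)
  thus ?thesis using poly_roots_finite[of "\<Prod>j=1..n. varpi_poly (pole \<alpha> \<gamma> \<nu> j)"]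
    by (simp add: varpi_poly_nonzero)
qed

lemma continuous_on_varpi: "continuous_on A (varpi w)"
  unfolding poly_varpi_poly[symmetric] by (intro continuous_intros)

lemma continuous_on_pi_prod: "continuous_on A (pi_prod \<alpha> \<gamma> \<nu> n)"
  unfolding pi_prod_def by (intro continuous_intros continuous_on_varpi)

lemma eventually_at_avoids_finite: "finite X \<Longrightarrow> eventually (\<lambda>z. z \<notin> X) (at (w::complex))"
  unfolding eventually_at_topological
  using finite_imp_closed[of "X - {w}"]
  by (intro exI[of _ "- (X - {w})"]) (simp add: open_Compl del: Compl_Diff_eq, simp)

lemma eventually_at_infinity_avoids_finite:
  "finite X \<Longrightarrow> eventually (\<lambda>z. z \<notin> X) (at_infinity :: complex filter)"
proof -
  assume "finite X"
  then obtain B where "\<And>z. z \<in> X \<Longrightarrow> norm z \<le> B" using finite_imp_bounded bounded_iff by metis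
  thus ?thesis unfolding eventually_at_infinity by (intro exI[of _ "B + 1"]) force
qed

text \<open>The finite exceptional set \<open>X\<close> absorbs the points where \<open>f\<close> carries the default value of a division by
  zero. The formula inherits exceptions of its own (zero, zeros of \<open>\<pi>\<^sub>n\<close>, reflections of exceptional
  points); all of them are isolated, so the removal of singularities repairs the value wherever \<open>\<pi>\<^sub>n\<close>
  does not vanish.\<close>

lemma recip_rational:
  assumes adm: "admissible_poles \<alpha> \<gamma>" and p: "degree p \<le> n" and X: "finite X"
    and f: "\<And>z. z \<notin> X \<Longrightarrow> pi_prod \<alpha> \<gamma> \<nu> n z \<noteq> 0 \<Longrightarrow> f z = poly p z / pi_prod \<alpha> \<gamma> \<nu> n z"
    and z: "pi_prod \<alpha> \<gamma> \<nu> n z \<noteq> 0"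
  shows "recip \<alpha> \<gamma> \<nu> n f z = varsigma \<alpha> (int n) * poly (rev_poly n p) z / pi_prod \<alpha> \<gamma> \<nu> n z"
proof -
  let ?pi = "pi_prod \<alpha> \<gamma> \<nu> n"
  let ?F = "\<lambda>z. varsigma \<alpha> (int n) * poly (rev_poly n p) z / ?pi z"
  let ?refl = "\<lambda>z. 1 / cnj z"
  \<comment> \<open>\<open>0\<close> is excluded because \<open>1 / cnj 0\<close> is the default value \<open>0\<close>.\<close>
  define E where "E = {0} \<union> {z. ?pi z = 0} \<union> ?refl -` (X \<union> {z. ?pi z = 0})"
  have "inj ?refl" by (rule injI) simp
  hence E: "finite E" unfolding E_def using X finite_zeros_pi_prod[of \<alpha> \<gamma> \<nu> n]
    by (intro finite_UnI finite_vimageI) auto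
  have eq: "Bfull \<alpha> \<gamma> \<nu> n y * substar f y = ?F y" if y: "y \<notin> E" for y
  proof -
    have y0: "y \<noteq> 0" "?pi y \<noteq> 0" "?pi (1 / cnj y) \<noteq> 0" and "1 / cnj y \<notin> X"
      using y by (auto simp: E_def)
    hence f': "f (1 / cnj y) = poly p (1 / cnj y) / ?pi (1 / cnj y)" using f by blast
    have "(\<Prod>j=1..n. varpi_star (pole \<alpha> \<gamma> \<nu> j) y) = (\<Prod>j=1..n. y * cnj (varpi (pole \<alpha> \<gamma> \<nu> j) (1 / cnj y)))"
      using y0(1) by (intro prod.cong refl varpi_star_via_varpi[symmetric])
    also have "\<dots> = y ^ n * cnj (?pi (1 / cnj y))" by (simp add: pi_prod_def prod.distrib)
    finally have "Bfull \<alpha> \<gamma> \<nu> n y = varsigma \<alpha> (int n) * (y ^ n * cnj (?pi (1 / cnj y))) / ?pi y"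
      unfolding Bfull_eq_prod_zeta[OF adm] zeta_def
      by (simp add: prod_dividef prod.distrib varsigma_def pi_prod_def)
    thus ?thesis using y0 f' by (simp add: substar_def poly_rev_poly[OF p y0(1)])
  qed
  have "eventually (\<lambda>y. ?F y = Bfull \<alpha> \<gamma> \<nu> n y * substar f y) (at z)"
    using eventually_at_avoids_finite[OF E] by eventually_elim (simp add: eq)
  moreover have "(?F \<longlongrightarrow> ?F z) (at z)"
  proof -
    have "(?pi \<longlongrightarrow> ?pi z) (at z)"
      using continuous_on_pi_prod[of UNIV \<alpha> \<gamma> \<nu> n] by (simp add: continuous_on_def)
    thus ?thesis using z by (intro tendsto_intros)
  qed
  ultimately have "((\<lambda>y. Bfull \<alpha> \<gamma> \<nu> n y * substar f y) \<longlongrightarrow> ?F z) (at z)"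
    by (rule Lim_transform_eventually[rotated])
  thus ?thesis unfolding recip_def by (rule remove_sings_eqI)
qed

lemma positive_limit_rotate:
  fixes f g :: "complex \<Rightarrow> complex"
  assumes c: "cmod c = 1" and F: "F \<noteq> bot" and eq: "eventually (\<lambda>z. g z = c * f z) F"
    and r: "r > 0" "(f \<longlongrightarrow> complex_of_real r) F"
  shows "(\<exists>s>0. (g \<longlongrightarrow> complex_of_real s) F) \<longleftrightarrow> c = 1"
proof
  have g: "(g \<longlongrightarrow> c * of_real r) F"
    using tendsto_mult_left[OF r(2), of c] eq by (subst tendsto_cong)
  assume "\<exists>s>0. (g \<longlongrightarrow> complex_of_real s) F"
  then obtain s where s: "s > 0" "(g \<longlongrightarrow> complex_of_real s) F" by blast
  have e: "complex_of_real s = c * of_real r" using tendsto_unique[OF F s(2) g] .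
  hence "s = r" using c s(1) r(1) by (metis abs_of_pos mult_1 norm_mult norm_of_real)
  thus "c = 1" using e r(1) by simp
next
  assume "c = 1"
  hence "(g \<longlongrightarrow> of_real r) F" using r(2) eq by (subst tendsto_cong) auto
  thus "\<exists>s>0. (g \<longlongrightarrow> complex_of_real s) F" using r(1) by blast
qed

lemma positive_at_rotate:
  assumes c: "cmod c = 1" and X: "finite X" and eq: "\<And>z. z \<notin> X \<Longrightarrow> g z = c * f z"
    and f: "positive_at f w"
  shows "positive_at g w \<longleftrightarrow> c = 1"
proof (cases w)
  case (Pt a)
  have "eventually (\<lambda>z. g z = c * f z) (at a)"
    using eventually_at_avoids_finite[OF X] by eventually_elim (simp add: eq)
  thus ?thesis using f Pt positive_limit_rotate[OF c, of "at a" g f] by auto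
next
  case Infpt
  have "eventually (\<lambda>z. g z = c * f z) at_infinity"
    using eventually_at_infinity_avoids_finite[OF X] by eventually_elim (simp add: eq)
  thus ?thesis using f Infpt positive_limit_rotate[OF c trivial_limit_at_infinity, of g f] by auto
qed

text \<open>The normalization fixes the phase of a function: rotating it multiplies its reciprocal, and so the value
  that has to be positive, by the conjugate of the rotation.\<close>

lemma normalized_rotate:
  assumes adm: "admissible_poles \<alpha> \<gamma>" and f: "f \<in> Lspace \<alpha> \<gamma> \<nu> n" "normalized \<alpha> \<gamma> \<nu> n f"
    and c: "cmod c = 1" and X: "finite X" and g: "\<And>z. z \<notin> X \<Longrightarrow> g z = c * f z"
  shows "normalized \<alpha> \<gamma> \<nu> n g \<longleftrightarrow> c = 1"
proof -
  let ?pi = "pi_prod \<alpha> \<gamma> \<nu> n" and ?p = "numer \<alpha> \<gamma> \<nu> n f"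
  note p = numer_properties[OF adm f(1)]
  have f_eq: "f z = poly ?p z / ?pi z" if "?pi z \<noteq> 0" for z
    using p(2)[OF that] that by simp
  have eq: "recip \<alpha> \<gamma> \<nu> n g z = cnj c * recip \<alpha> \<gamma> \<nu> n f z" if z: "z \<notin> {z. ?pi z = 0}" for z
  proof -
    have "recip \<alpha> \<gamma> \<nu> n g z = varsigma \<alpha> (int n) * poly (rev_poly n (smult c ?p)) z / ?pi z"
      using z p(1) g f_eq by (intro recip_rational[OF adm _ X]) (auto intro: order_trans[OF degree_smult_le])
    moreover have "recip \<alpha> \<gamma> \<nu> n f z = varsigma \<alpha> (int n) * poly (rev_poly n ?p) z / ?pi z"
      using z p(1) f_eq by (intro recip_rational[OF adm _ finite.emptyI]) auto
    ultimately show ?thesis by (simp add: rev_poly_smult)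
  qed
  have c': "cmod (cnj c) = 1" "cnj c = 1 \<longleftrightarrow> c = 1" using c by auto
  have pos: "positive_at (\<lambda>z. recip \<alpha> \<gamma> \<nu> n g z / h z) w \<longleftrightarrow> c = 1"
    if h: "positive_at (\<lambda>z. recip \<alpha> \<gamma> \<nu> n f z / h z) w" for h w
    unfolding c'(2)[symmetric]
    by (rule positive_at_rotate[OF c'(1) finite_zeros_pi_prod[of \<alpha> \<gamma> \<nu> n] _ h]) (subst eq, assumption, simp)
  from pos[of "\<lambda>_. 1"] have pos1: "positive_at (recip \<alpha> \<gamma> \<nu> n g) w \<longleftrightarrow> c = 1"
    if "positive_at (recip \<alpha> \<gamma> \<nu> n f) w" for w
    using that by simp
  show ?thesis
  proof (cases \<nu>)
    case Alpha
    thus ?thesis using f(2) pos1 by (simp del: positive_at.simps)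
  next
    case Beta
    thus ?thesis using f(2) pos1 by (simp del: positive_at.simps)
  next
    case Gamma
    show ?thesis
    proof (cases "\<gamma> n = Pt (\<alpha> n)")
      case True
      thus ?thesis using f(2) pos[of "Bdot_beta \<alpha> \<gamma> n" "Pt (\<alpha> n)"] Gamma
        by (simp del: positive_at.simps)
    next
      case False
      thus ?thesis using f(2) pos[of "Bdot_alpha \<alpha> \<gamma> n" "beta_point (\<alpha> n)"] Gamma
        by (simp del: positive_at.simps)
    qed
  qed
qed

section \<open>Orthogonality of the numerators\<close>

lemma Bl_0: "Bl \<alpha> \<gamma> \<nu> 0 z = 1"
  by (cases \<nu>) auto

lemma const_in_Lspace_0: "(\<lambda>_. c) \<in> Lspace \<alpha> \<gamma> \<nu> 0"
  unfolding Lspace_def by (auto intro!: exI[of _ "\<lambda>_. c"] simp: Bl_0)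

lemma Lspace_Suc_combine:
  assumes "g \<in> Lspace \<alpha> \<gamma> \<nu> n" "f \<in> Lspace \<alpha> \<gamma> \<nu> (Suc n)"
  shows "(\<lambda>z. g z + c * f z) \<in> Lspace \<alpha> \<gamma> \<nu> (Suc n)"
proof -
  obtain a b where ab: "g = (\<lambda>z. \<Sum>k\<le>n. a k * Bl \<alpha> \<gamma> \<nu> k z)" "f = (\<lambda>z. \<Sum>k\<le>Suc n. b k * Bl \<alpha> \<gamma> \<nu> k z)"
    using assms by (auto simp: Lspace_def)
  let ?d = "\<lambda>k. (if k \<le> n then a k else 0) + c * b k"
  have "g z + c * f z = (\<Sum>k\<le>Suc n. ?d k * Bl \<alpha> \<gamma> \<nu> k z)" for z
    by (simp add: ab algebra_simps sum.distrib sum_distrib_left)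
  thus ?thesis unfolding Lspace_def by (auto intro!: exI[of _ ?d])
qed

locale orthonormal_system =
  fixes \<alpha> :: "nat \<Rightarrow> complex" and \<gamma> :: "nat \<Rightarrow> xpoint" and \<nu> :: family
    and \<mu> :: "complex measure" and \<phi> :: "nat \<Rightarrow> complex \<Rightarrow> complex"
  assumes adm: "admissible_poles \<alpha> \<gamma>"
    and pos: "positive_ae_prob \<mu>"
    and onf: "orthonormal_functions \<mu> \<alpha> \<gamma> \<nu> \<phi>"
begin

abbreviation pt :: "nat \<Rightarrow> xpoint" where "pt j \<equiv> pole \<alpha> \<gamma> \<nu> j"

abbreviation den :: "nat \<Rightarrow> complex \<Rightarrow> complex" where "den n z \<equiv> pi_prod \<alpha> \<gamma> \<nu> n z"

definition num :: "nat \<Rightarrow> complex poly" where "num n = numer \<alpha> \<gamma> \<nu> n (\<phi> n)"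

abbreviation num_star :: "nat \<Rightarrow> complex poly" where "num_star n \<equiv> rev_poly n (num n)"

text \<open>The inner product of \<open>r / \<pi>\<^sub>m\<close> and \<open>s / \<pi>\<^sub>m\<close>. Working with a common denominator makes functions from
  different levels comparable as polynomials.\<close>

definition bracket :: "nat \<Rightarrow> complex poly \<Rightarrow> complex poly \<Rightarrow> complex" where
  "bracket m r s = (LINT z|\<mu>. cnj (poly r z) * poly s z / (den m z * cnj (den m z)))"

lemma phi_0: "\<phi> 0 = (\<lambda>_. 1)"
  using onf by (simp add: orthonormal_functions_def)

lemma phi_Suc:
  "\<phi> (Suc n) \<in> Lspace \<alpha> \<gamma> \<nu> (Suc n)"
  "g \<in> Lspace \<alpha> \<gamma> \<nu> n \<Longrightarrow> ip \<mu> g (\<phi> (Suc n)) = 0"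
  "ip \<mu> (\<phi> (Suc n)) (\<phi> (Suc n)) = 1"
  "normalized \<alpha> \<gamma> \<nu> (Suc n) (\<phi> (Suc n))"
  using onf by (auto simp: orthonormal_functions_def)

lemma phi_in_Lspace: "\<phi> n \<in> Lspace \<alpha> \<gamma> \<nu> n"
  by (cases n) (auto simp: phi_0 phi_Suc const_in_Lspace_0)

lemma degree_num: "degree (num n) \<le> n"
  unfolding num_def by (rule numer_properties(1)[OF adm phi_in_Lspace])

lemma phi_eq: "den n z \<noteq> 0 \<Longrightarrow> \<phi> n z = poly (num n) z / den n z"
  unfolding num_def using numer_properties(2)[OF adm phi_in_Lspace, of n z] by simp

lemma recip_phi_eq:
  "den n z \<noteq> 0 \<Longrightarrow> recip \<alpha> \<gamma> \<nu> n (\<phi> n) z = varsigma \<alpha> (int n) * poly (num_star n) z / den n z"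
  by (rule recip_rational[OF adm degree_num finite.emptyI phi_eq])

lemma num_0: "num 0 = 1"
  unfolding num_def by (rule numer_unique) (simp add: phi_0 pi_prod_def)

lemma den_Suc: "den (Suc n) z = den n z * varpi (pt (Suc n)) z"
  by (simp add: pi_prod_def)

lemma den_circle: "cmod z = 1 \<Longrightarrow> den n z \<noteq> 0"
  unfolding pi_prod_def
  using varpi_nonzero_on_circle[OF off_circle_pole[OF adm]] by (auto simp: prod_zero_iff)

lemma space_mu: "z \<in> space \<mu> \<longleftrightarrow> cmod z = 1"
  by (simp add: space_positive_ae[OF pos])

lemma integral_cong_circle:
  assumes "\<And>z. cmod z = 1 \<Longrightarrow> f z = g z"
  shows "integral\<^sup>L \<mu> f = integral\<^sup>L \<mu> g"
  by (rule Bochner_Integration.integral_cong[OF refl]) (use assms space_mu in auto)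

lemma integrable_bracket: "integrable \<mu> (\<lambda>z. cnj (poly r z) * poly s z / (den m z * cnj (den m z)))"
  by (rule integrable_continuous_on_circle[OF pos])
     (auto intro!: continuous_intros continuous_on_pi_prod simp: den_circle)

lemma bracket_add_smult: "bracket m r (s + smult c t) = bracket m r s + c * bracket m r t"
proof -
  have "bracket m r (s + smult c t) =
    (LINT z|\<mu>. cnj (poly r z) * poly s z / (den m z * cnj (den m z)) +
               c * (cnj (poly r z) * poly t z / (den m z * cnj (den m z))))"
    unfolding bracket_def by (rule integral_cong_circle) (simp add: ring_distribs add_divide_distrib mult_ac)
  also have "\<dots> = bracket m r s + c * bracket m r t"
    unfolding bracket_def integral_mult_right_zero[symmetric]
    by (intro Bochner_Integration.integral_add integrable_mult_right integrable_bracket)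
  finally show ?thesis .
qed

lemma bracket_self:
  "bracket m r r = of_real (LINT z|\<mu>. (cmod (poly r z / den m z))\<^sup>2)"
  unfolding bracket_def integral_complex_of_real[symmetric]
  by (rule integral_cong_circle) (simp only: complex_norm_square complex_cnj_divide times_divide_times_eq mult_ac)

lemma continuous_bracket_self: "continuous_on (sphere 0 1) (\<lambda>z. (cmod (poly r z / den m z))\<^sup>2)"
  by (auto intro!: continuous_intros continuous_on_pi_prod simp: den_circle)

lemma bracket_definite:
  assumes "bracket m r r = 0"
  shows "r = 0"
proof (rule ccontr)
  assume "r \<noteq> 0"
  have "infinite {z. cmod z = 1 \<and> (cmod (poly r z / den m z))\<^sup>2 = 0}"
    using assms by (intro zeros_of_null_integral[OF pos continuous_bracket_self]) (auto simp: bracket_self)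
  moreover have "{z. cmod z = 1 \<and> (cmod (poly r z / den m z))\<^sup>2 = 0} \<subseteq> {z. poly r z = 0}"
    using den_circle by auto
  ultimately show False using poly_roots_finite[OF \<open>r \<noteq> 0\<close>] finite_subset by blast
qed

text \<open>Two facts that feed each other. If \<open>p\<^sub>n\<close> were divisible by \<open>\<varpi>\<^sub>n\<close>, then \<open>\<phi>\<^sub>n\<close> would agree on the circle
  with an element of the previous space and be orthogonal to itself; so \<open>q\<^sub>n(\<nu>\<^sub>n) \<noteq> 0\<close>. Conversely, that
  value being nonzero, subtracting a multiple of \<open>p\<^sub>n\<close> makes any polynomial divisible by \<open>\<varpi>\<^sub>n\<close>, which
  shows inductively that the space contains all \<open>p / \<pi>\<^sub>n\<close> with \<open>p\<close> of degree at most \<open>n\<close>.\<close>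

lemma num_star_nonzero_and_rational_in_Lspace:
  "peval n (num_star n) (pt n) \<noteq> 0 \<and>
   (\<forall>p. degree p \<le> n \<longrightarrow> (\<exists>g\<in>Lspace \<alpha> \<gamma> \<nu> n. \<forall>z. den n z \<noteq> 0 \<longrightarrow> g z = poly p z / den n z))"
proof (induction n)
  case 0
  have "\<exists>g\<in>Lspace \<alpha> \<gamma> \<nu> 0. \<forall>z. den 0 z \<noteq> 0 \<longrightarrow> g z = poly p z / den 0 z" if "degree p \<le> 0" for p
  proof (rule bexI[OF _ const_in_Lspace_0[of "coeff p 0"]])
    show "\<forall>z. den 0 z \<noteq> 0 \<longrightarrow> coeff p 0 = poly p z / den 0 z"
      using that by (auto simp: pi_prod_def poly_altdef)
  qed
  moreover have "peval 0 (num_star 0) w \<noteq> 0" for w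
    by (cases w) (auto simp: num_0 rev_poly_def)
  ultimately show ?case by blast
next
  case (Suc n)
  let ?w = "pt (Suc n)"
  have quot: "\<exists>g\<in>Lspace \<alpha> \<gamma> \<nu> n. \<forall>z. den (Suc n) z \<noteq> 0 \<longrightarrow> g z = poly p z / den (Suc n) z"
    if p: "degree p \<le> Suc n" "peval (Suc n) (rev_poly (Suc n) p) ?w = 0" for p
  proof -
    obtain t where t: "p = varpi_poly ?w * t" "t = 0 \<or> degree t < Suc n" using varpi_dvd[OF p] .
    hence "degree t \<le> n" by auto
    then obtain g where g: "g \<in> Lspace \<alpha> \<gamma> \<nu> n" "\<And>z. den n z \<noteq> 0 \<Longrightarrow> g z = poly t z / den n z"
      using Suc.IH by blast
    show ?thesis using g by (intro bexI[OF _ g(1)]) (auto simp: t(1) den_Suc poly_varpi_poly)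
  qed
  have nz: "peval (Suc n) (num_star (Suc n)) ?w \<noteq> 0"
  proof
    assume 0: "peval (Suc n) (num_star (Suc n)) ?w = 0"
    obtain g where g: "g \<in> Lspace \<alpha> \<gamma> \<nu> n"
      "\<And>z. den (Suc n) z \<noteq> 0 \<Longrightarrow> g z = poly (num (Suc n)) z / den (Suc n) z"
      using quot[OF degree_num 0] by blast
    have "ip \<mu> g (\<phi> (Suc n)) = ip \<mu> (\<phi> (Suc n)) (\<phi> (Suc n))"
      unfolding ip_def by (rule integral_cong_circle) (simp add: g(2) phi_eq den_circle)
    thus False using phi_Suc(2)[OF g(1)] phi_Suc(3) by simp
  qed
  have "\<exists>g\<in>Lspace \<alpha> \<gamma> \<nu> (Suc n). \<forall>z. den (Suc n) z \<noteq> 0 \<longrightarrow> g z = poly p z / den (Suc n) z"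
    if p: "degree p \<le> Suc n" for p
  proof -
    define c where "c = cnj (peval (Suc n) (rev_poly (Suc n) p) ?w / peval (Suc n) (num_star (Suc n)) ?w)"
    let ?r = "p + smult (- c) (num (Suc n))"
    have "degree ?r \<le> Suc n" using p degree_num[of "Suc n"]
      by (intro degree_add_le) (auto intro: order_trans[OF degree_smult_le])
    moreover have "peval (Suc n) (rev_poly (Suc n) ?r) ?w = 0"
      using nz by (simp add: rev_poly_add rev_poly_smult peval_add peval_smult c_def
          del: smult_minus_left)
    ultimately obtain g where g: "g \<in> Lspace \<alpha> \<gamma> \<nu> n"
      "\<And>z. den (Suc n) z \<noteq> 0 \<Longrightarrow> g z = poly ?r z / den (Suc n) z"
      using quot by blast
    show ?thesis
    proof (rule bexI[OF _ Lspace_Suc_combine[OF g(1) phi_Suc(1), of c]], intro allI impI)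
      fix z assume "den (Suc n) z \<noteq> 0"
      thus "g z + c * \<phi> (Suc n) z = poly p z / den (Suc n) z"
        by (simp add: g(2) phi_eq field_simps)
    qed
  qed
  thus ?case using nz by blast
qed

lemmas num_star_nonzero = num_star_nonzero_and_rational_in_Lspace[THEN conjunct1]

lemma num_nonzero: "num n \<noteq> 0"
proof
  assume "num n = 0"
  thus False using num_star_nonzero[of n] by (cases "pt n") (auto simp: rev_poly_def)
qed

text \<open>A test function \<open>r / \<pi>\<^sub>m\<^sub>-\<^sub>1\<close> from the previous space acquires the factor \<open>\<varpi>\<^sub>m\<close> over the denominator \<open>\<pi>\<^sub>m\<close>.\<close>

lemma num_orthogonal:
  assumes "degree r < m"
  shows "bracket m (varpi_poly (pt m) * r) (num m) = 0"
proof -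
  obtain n where n: "m = Suc n" "degree r \<le> n" using assms by (cases m) auto
  then obtain g where g: "g \<in> Lspace \<alpha> \<gamma> \<nu> n" "\<And>z. den n z \<noteq> 0 \<Longrightarrow> g z = poly r z / den n z"
    using num_star_nonzero_and_rational_in_Lspace[of n] by blast
  have "bracket m (varpi_poly (pt m) * r) (num m) = ip \<mu> g (\<phi> m)"
    unfolding bracket_def ip_def
  proof (rule integral_cong_circle)
    fix z :: complex assume z: "cmod z = 1"
    have "varpi (pt (Suc n)) z \<noteq> 0" "den n z \<noteq> 0"
      using den_circle[OF z, of "Suc n"] by (auto simp: den_Suc)
    thus "cnj (poly (varpi_poly (pt m) * r) z) * poly (num m) z / (den m z * cnj (den m z)) = cnj (g z) * \<phi> m z"
      by (simp add: n(1) g(2) phi_eq den_Suc poly_varpi_poly divide_simps)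
  qed
  thus ?thesis using phi_Suc(2)[OF g(1)] n(1) by simp
qed

text \<open>The difference to a suitable multiple of \<open>p\<^sub>m\<close> is divisible by \<open>\<varpi>\<^sub>m\<close>, so it is one of the test functions to
  which it is orthogonal.\<close>

lemma orthogonal_imp_multiple_num:
  assumes t: "degree t \<le> m" and orth: "\<And>r. degree r < m \<Longrightarrow> bracket m (varpi_poly (pt m) * r) t = 0"
  obtains c where "t = smult c (num m)"
proof -
  define c where "c = cnj (peval m (rev_poly m t) (pt m) / peval m (num_star m) (pt m))"
  let ?d = "t + smult (- c) (num m)"
  have "degree ?d \<le> m" using t degree_num[of m]
    by (intro degree_add_le) (auto intro: order_trans[OF degree_smult_le])
  moreover have "peval m (rev_poly m ?d) (pt m) = 0"
    using num_star_nonzero[of m]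
    by (simp add: rev_poly_add rev_poly_smult peval_add peval_smult c_def del: smult_minus_left)
  ultimately obtain u where u: "?d = varpi_poly (pt m) * u" "u = 0 \<or> degree u < m"
    using varpi_dvd by blast
  have "?d = 0"
  proof (cases "u = 0")
    case False
    hence "bracket m (varpi_poly (pt m) * u) ?d = 0"
      using u(2) orth num_orthogonal by (simp add: bracket_add_smult del: smult_minus_left)
    thus ?thesis unfolding u(1) by (rule bracket_definite)
  qed (use u in simp)
  hence "t = smult c (num m)" by (simp add: eq_neg_iff_add_eq_0)
  thus ?thesis by (rule that)
qed

section \<open>The two-dimensional space behind the recursion\<close>

text \<open>Orthogonality to \<open>z, ..., z\<^sup>m\<close>: a set of exponents that is symmetric under the reversal of degree \<open>m + 1\<close>.\<close>

definition shift_orthogonal :: "nat \<Rightarrow> complex poly \<Rightarrow> bool" where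
  "shift_orthogonal m s \<longleftrightarrow>
     degree s \<le> Suc m \<and> (\<forall>r. degree r < m \<longrightarrow> bracket m (pCons 0 r) s = 0)"

lemma shift_orthogonal_combine:
  assumes "shift_orthogonal m s" "shift_orthogonal m t"
  shows "shift_orthogonal m (s + smult c t)"
  using assms unfolding shift_orthogonal_def
  by (auto simp: bracket_add_smult intro!: degree_add_le intro: order_trans[OF degree_smult_le])

text \<open>The test functions \<open>\<varpi>\<^sub>m\<^sub>+\<^sub>1 \<varpi>\<^sub>m\<^sub>+\<^sub>1\<^sup>* r\<close> for \<open>p\<^sub>m\<^sub>+\<^sub>1\<close> become \<open>z r\<close> after cancelling \<open>|\<varpi>\<^sub>m\<^sub>+\<^sub>1|\<^sup>2\<close>, because
  \<open>\<varpi> \<varpi>\<^sup>* = z |\<varpi>|\<^sup>2\<close> on the circle.\<close>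

lemma shift_orthogonal_num: "shift_orthogonal m (num (Suc m))"
  unfolding shift_orthogonal_def
proof (intro conjI allI impI degree_num)
  fix r :: "complex poly" assume r: "degree r < m"
  let ?w = "pt (Suc m)"
  have "bracket m (pCons 0 r) (num (Suc m)) =
        bracket (Suc m) (varpi_poly ?w * (varpi_star_poly ?w * r)) (num (Suc m))"
    unfolding bracket_def
  proof (rule integral_cong_circle)
    fix z :: complex assume z: "cmod z = 1"
    have nz: "varpi ?w z \<noteq> 0" "den m z \<noteq> 0"
      using den_circle[OF z, of "Suc m"] by (auto simp: den_Suc)
    have "cnj (varpi ?w z * varpi_star ?w z) = cnj z * (varpi ?w z * cnj (varpi ?w z))"
    proof -
      have "cnj (varpi_star ?w z) = cnj z * varpi ?w z"
      proof -
        have "varpi ?w z = z * cnj (varpi_star ?w z)"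
          using arg_cong[OF cnj_varpi_on_circle[OF z, of ?w], of cnj] by simp
        thus ?thesis using z by (simp add: mult.assoc[symmetric] mult.commute[of "cnj z"] mult_cnj_eq_1_iff[THEN iffD2])
      qed
      thus ?thesis by simp
    qed
    hence e: "cnj (varpi ?w z) * cnj (varpi_star ?w z) = cnj z * (varpi ?w z * cnj (varpi ?w z))" by simp
    show "cnj (poly (pCons 0 r) z) * poly (num (Suc m)) z / (den m z * cnj (den m z)) =
      cnj (poly (varpi_poly ?w * (varpi_star_poly ?w * r)) z) * poly (num (Suc m)) z /
      (den (Suc m) z * cnj (den (Suc m) z))"
      using nz by (simp add: den_Suc poly_varpi_poly poly_varpi_star_poly mult.assoc[symmetric] e)
  qed
  also have "degree (varpi_star_poly ?w * r) < Suc m"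
    using r degree_varpi_star_mult[of r "m - 1" ?w] by (cases m) auto
  hence "bracket (Suc m) (varpi_poly ?w * (varpi_star_poly ?w * r)) (num (Suc m)) = 0"
    by (rule num_orthogonal)
  finally show "bracket m (pCons 0 r) (num (Suc m)) = 0" .
qed

lemma bracket_shift_varpi_star:
  "bracket m (pCons 0 r) (varpi_star_poly (pt m) * t) = bracket m (varpi_poly (pt m) * r) t"
  unfolding bracket_def
  by (rule integral_cong_circle)
     (simp add: poly_varpi_poly poly_varpi_star_poly cnj_varpi_on_circle mult_ac)

lemma shift_orthogonal_varpi_star:
  "shift_orthogonal m (varpi_star_poly (pt m) * num m)"
  unfolding shift_orthogonal_def
  by (simp add: bracket_shift_varpi_star num_orthogonal degree_varpi_star_mult degree_num)

text \<open>On the circle reversal is conjugation followed by multiplication with \<open>z\<^sup>m\<^sup>+\<^sup>1\<close>, which permutes the test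
  functions \<open>z, ..., z\<^sup>m\<close>.\<close>

lemma shift_orthogonal_rev:
  assumes "shift_orthogonal m s"
  shows "shift_orthogonal m (rev_poly (Suc m) s)"
  unfolding shift_orthogonal_def
proof (intro conjI allI impI degree_rev_poly)
  fix r :: "complex poly" assume r: "degree r < m"
  then obtain k where k: "m = Suc k" "degree r \<le> k" by (cases m) auto
  have s: "degree s \<le> Suc m" using assms by (simp add: shift_orthogonal_def)
  have "bracket m (pCons 0 r) (rev_poly (Suc m) s) = cnj (bracket m (pCons 0 (rev_poly k r)) s)"
    unfolding bracket_def Bochner_Integration.integral_cnj[symmetric]
  proof (rule integral_cong_circle)
    fix z :: complex assume z: "cmod z = 1"
    hence z0: "z \<noteq> 0" by auto
    have zz: "z * cnj z = 1" using z by (simp add: mult_cnj_eq_1_iff)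
    hence inv: "1 / cnj z = z" using z0 by (simp add: divide_simps)
    have "cnj z * z ^ Suc m = z * z ^ k"
    proof -
      have "cnj z * z ^ Suc m = (z * cnj z) * (z * z ^ k)" by (simp add: k(1) mult_ac)
      thus ?thesis by (simp add: zz)
    qed
    thus "cnj (poly (pCons 0 r) z) * poly (rev_poly (Suc m) s) z / (den m z * cnj (den m z)) =
       cnj (cnj (poly (pCons 0 (rev_poly k r)) z) * poly s z / (den m z * cnj (den m z)))"
      by (simp add: poly_rev_poly[OF s z0] poly_rev_poly[OF k(2) z0] inv mult_ac del: power_Suc)
  qed
  also have "\<dots> = 0"
    using assms degree_rev_poly[of k r] k(1) by (simp add: shift_orthogonal_def)
  finally show "bracket m (pCons 0 r) (rev_poly (Suc m) s) = 0" .
qed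

lemma shift_orthogonal_varpi_num_star:
  "shift_orthogonal m (varpi_poly (pt m) * num_star m)"
  using shift_orthogonal_rev[OF shift_orthogonal_varpi_star[of m]]
  by (simp add: rev_poly_varpi_star degree_num)

lemma peval_varpi_num_star:
  "peval (Suc m) (varpi_poly (pt m) * num_star m) (pt m) = diag_value (pt m) * peval m (num_star m) (pt m)"
  by (rule peval_varpi_mult[OF degree_rev_poly])

lemma diag_value_pt: "diag_value (pt m) \<noteq> 0"
  by (rule diag_value_nonzero[OF off_circle_pole[OF adm]])

text \<open>Choosing \<open>B\<close> such that the remainder vanishes at the pole makes it a multiple of \<open>\<varpi>\<^sub>m\<^sup>*\<close>, and the cofactor
  satisfies the orthogonality relations that determine \<open>p\<^sub>m\<close> up to a constant.\<close>

lemma shift_orthogonal_spanned: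
  assumes "shift_orthogonal m s"
  obtains A B where
    "s = smult A (varpi_star_poly (pt m) * num m) + smult B (varpi_poly (pt m) * num_star m)"
proof -
  \<comment> \<open>The denominator is \<open>\<varpi>\<^sub>m(\<nu>\<^sub>m) q\<^sub>m(\<nu>\<^sub>m)\<close>, nonzero because the pole is off the circle
    and \<open>\<varpi>\<^sub>m\<close> does not divide \<open>p\<^sub>m\<close>.\<close>
  define B where "B = peval (Suc m) s (pt m) / peval (Suc m) (varpi_poly (pt m) * num_star m) (pt m)"
  let ?d = "s + smult (- B) (varpi_poly (pt m) * num_star m)"
  have d: "shift_orthogonal m ?d"
    by (rule shift_orthogonal_combine[OF assms shift_orthogonal_varpi_num_star])
  have "peval (Suc m) ?d (pt m) = 0"
    using num_star_nonzero[of m] diag_value_pt[of m]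
    by (simp add: peval_add peval_smult B_def peval_varpi_num_star del: smult_minus_left)
  then obtain t where t: "?d = varpi_star_poly (pt m) * t" "t = 0 \<or> degree t < Suc m"
    using d varpi_star_dvd unfolding shift_orthogonal_def by blast
  have orth: "bracket m (varpi_poly (pt m) * r) t = 0" if "degree r < m" for r
    using d that unfolding t(1) shift_orthogonal_def by (simp add: bracket_shift_varpi_star)
  have "degree t \<le> m" using t(2) by auto
  then obtain A where A: "t = smult A (num m)"
    using orth by (rule orthogonal_imp_multiple_num)
  have "s = ?d + smult B (varpi_poly (pt m) * num_star m)" by simp
  also have "\<dots> = smult A (varpi_star_poly (pt m) * num m) + smult B (varpi_poly (pt m) * num_star m)"
    unfolding t(1) A by simp
  finally show ?thesis by (rule that)
qed

lemma num_Suc_recursion: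
  obtains A B where
    "num (Suc m) = smult A (varpi_star_poly (pt m) * num m) + smult B (varpi_poly (pt m) * num_star m)"
    "num_star (Suc m) =
       smult (cnj A) (varpi_poly (pt m) * num_star m) + smult (cnj B) (varpi_star_poly (pt m) * num m)"
proof -
  obtain A B where AB: "num (Suc m) =
      smult A (varpi_star_poly (pt m) * num m) + smult B (varpi_poly (pt m) * num_star m)"
    using shift_orthogonal_spanned[OF shift_orthogonal_num] .
  show ?thesis
  proof (rule that[OF AB])
    show "num_star (Suc m) =
       smult (cnj A) (varpi_poly (pt m) * num_star m) + smult (cnj B) (varpi_star_poly (pt m) * num m)"
      by (subst AB) (simp add: rev_poly_add rev_poly_smult rev_poly_varpi_star rev_poly_varpi
          degree_num degree_rev_poly rev_poly_rev_poly)
  qed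
qed

section \<open>Regularity for one-sided pole sequences\<close>

text \<open>For the reflected family \<open>\<varpi>\<close> is a constant times \<open>z - \<alpha>\<close>, and on the circle
  \<open>cnj (z - \<alpha>\<^sub>k) (z - \<alpha>\<^sub>m)\<close> is the product of the other type with the two points exchanged.\<close>

lemma cnj_varpi_mult_varpi_one_sided:
  assumes "\<nu> \<noteq> Gamma"
  obtains \<kappa> a c where "\<kappa> \<noteq> 0" "cmod a < 1" "cmod c < 1"
    "\<And>z. cmod z = 1 \<Longrightarrow> cnj (varpi (pt k) z) * varpi (pt m) z = \<kappa> * ((1 - a * cnj z) * (1 - cnj c * z))"
proof (cases \<nu>)
  case Alpha
  thus ?thesis using that[of 1 "\<alpha> k" "\<alpha> m"] admissible_pole(1)[OF adm] by simp
next
  case Beta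
  \<comment> \<open>At \<open>a = 0\<close> the reflected point is infinity, with factor \<open>- z\<close>.\<close>
  define \<kappa> where "\<kappa> a = (if a = 0 then - 1 else - 1 / a)" for a :: complex
  have \<kappa>0: "\<kappa> a \<noteq> 0" for a by (simp add: \<kappa>_def)
  have v: "varpi (beta_point a) z = \<kappa> a * (z - a)" for a z
    by (simp add: beta_point_def \<kappa>_def field_simps)
  show ?thesis
  proof (rule that)
    show "cnj (\<kappa> (\<alpha> k)) * \<kappa> (\<alpha> m) \<noteq> 0" using \<kappa>0 by simp
    show "cmod (\<alpha> m) < 1" "cmod (\<alpha> k) < 1" using admissible_pole(1)[OF adm] by auto
    fix z assume "cmod z = 1"
    hence zz: "z * cnj z = 1" by (simp add: mult_cnj_eq_1_iff)
    have "(cnj z - cnj (\<alpha> k)) * (z - \<alpha> m) = (1 - \<alpha> m * cnj z) * (1 - cnj (\<alpha> k) * z)"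
    proof -
      have "(1 - \<alpha> m * cnj z) * (1 - cnj (\<alpha> k) * z) - (cnj z - cnj (\<alpha> k)) * (z - \<alpha> m) =
        (1 - z * cnj z) * (1 - \<alpha> m * cnj (\<alpha> k))" by (simp add: algebra_simps)
      thus ?thesis by (simp add: zz)
    qed
    thus "cnj (varpi (pt k) z) * varpi (pt m) z =
        cnj (\<kappa> (\<alpha> k)) * \<kappa> (\<alpha> m) * ((1 - \<alpha> m * cnj z) * (1 - cnj (\<alpha> k) * z))"
      using Beta by (simp add: v)
  qed
qed (use assms in simp)

text \<open>This is the coefficient \<open>A\<close> of the recursion being nonzero. Otherwise, testing \<open>\<phi>\<^sub>m\<^sub>+\<^sub>1\<close> against \<open>q\<^sub>m / \<pi>\<^sub>m\<close>
  would give a vanishing mean of \<open>cnj \<varpi>\<^sub>m\<^sub>+\<^sub>1 \<varpi>\<^sub>m\<close> with the nonnegative weight \<open>|q\<^sub>m / \<pi>\<^sub>m\<^sub>+\<^sub>1|\<^sup>2\<close>.\<close>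

lemma num_not_multiple_varpi_num_star:
  assumes "\<nu> \<noteq> Gamma"
  shows "num (Suc m) \<noteq> smult B (varpi_poly (pt m) * num_star m)"
proof
  assume eq: "num (Suc m) = smult B (varpi_poly (pt m) * num_star m)"
  hence B: "B \<noteq> 0" using num_nonzero[of "Suc m"] by auto
  obtain \<kappa> a c where \<kappa>: "\<kappa> \<noteq> 0" and ac: "cmod a < 1" "cmod c < 1" and
    fac: "\<And>z. cmod z = 1 \<Longrightarrow> cnj (varpi (pt (Suc m)) z) * varpi (pt m) z = \<kappa> * ((1 - a * cnj z) * (1 - cnj c * z))"
    using cnj_varpi_mult_varpi_one_sided[OF assms, of "Suc m" m] by blast
  let ?g = "\<lambda>z. (cmod (poly (num_star m) z / den (Suc m) z))\<^sup>2"
  have q0: "num_star m \<noteq> 0" using num_star_nonzero[of m] by (cases "pt m") auto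
  have "bracket (Suc m) (num_star m) (num_star m) \<noteq> 0" using bracket_definite q0 by blast
  hence mass: "integral\<^sup>L \<mu> ?g > 0"
    by (subst less_le) (auto simp: bracket_self)
  have "0 = bracket (Suc m) (varpi_poly (pt (Suc m)) * num_star m) (num (Suc m))"
    using num_orthogonal[of "num_star m" "Suc m"] degree_rev_poly[of m "num m"] by simp
  also have "\<dots> = (LINT z|\<mu>. B * \<kappa> * (complex_of_real (?g z) * ((1 - a * cnj z) * (1 - cnj c * z))))"
    unfolding bracket_def eq
  proof (rule integral_cong_circle)
    fix z :: complex assume z: "cmod z = 1"
    have "complex_of_real (?g z) =
        poly (num_star m) z * cnj (poly (num_star m) z) / (den (Suc m) z * cnj (den (Suc m) z))"
      by (simp add: complex_norm_square flip: of_real_power)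
    thus "cnj (poly (varpi_poly (pt (Suc m)) * num_star m) z) * poly (smult B (varpi_poly (pt m) * num_star m)) z /
         (den (Suc m) z * cnj (den (Suc m) z)) =
         B * \<kappa> * (complex_of_real (?g z) * ((1 - a * cnj z) * (1 - cnj c * z)))"
      using fac[OF z, symmetric] by (simp add: poly_varpi_poly mult_ac)
  qed
  also have "\<dots> = B * \<kappa> * (LINT z|\<mu>. complex_of_real (?g z) * ((1 - a * cnj z) * (1 - cnj c * z)))"
    by (rule integral_mult_right_zero)
  finally show False
    using B \<kappa> moebius_average_nonzero[OF pos continuous_bracket_self _ mass ac] by simp
qed

end

section \<open>The recursion\<close>

lemma recursion_rhs_components:
  fixes \<alpha> \<gamma> \<nu> \<phi> n z e \<eta>1 \<eta>2
  defines "k \<equiv> varpi (pole \<alpha> \<gamma> \<nu> (n - 1)) z / varpi (pole \<alpha> \<gamma> \<nu> n) z"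
    and "x \<equiv> zeta \<alpha> \<gamma> \<nu> (n - 1) z * \<phi> (n - 1) z"
    and "y \<equiv> recip \<alpha> \<gamma> \<nu> (n - 1) (\<phi> (n - 1)) z"
    and "l \<equiv> lambda_par \<alpha> \<gamma> \<nu> \<phi> n"
  shows "recursion_rhs \<alpha> \<gamma> \<nu> \<phi> n (H_mat e \<eta>1 \<eta>2) z $ 1 = k * (e * \<eta>1 * (x + l * y))"
    and "recursion_rhs \<alpha> \<gamma> \<nu> \<phi> n (H_mat e \<eta>1 \<eta>2) z $ 2 = k * (e * \<eta>2 * (cnj l * x + y))"
  unfolding recursion_rhs_def H_mat_def mat2_def assms
  by (simp_all add: matrix_matrix_mult_def matrix_vector_mult_def mat_def sum_2 algebra_simps)

lemma recip_const_1:
  assumes "admissible_poles \<alpha> \<gamma>"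
  shows "recip \<alpha> \<gamma> \<nu> 0 (\<lambda>_. 1) = (\<lambda>_. 1)"
proof
  fix z :: complex
  have "recip \<alpha> \<gamma> \<nu> 0 (\<lambda>_. 1) z = varsigma \<alpha> (int 0) * poly (rev_poly 0 1) z / pi_prod \<alpha> \<gamma> \<nu> 0 z"
    by (rule recip_rational[OF assms _ finite.emptyI]) (auto simp: pi_prod_def)
  thus "recip \<alpha> \<gamma> \<nu> 0 (\<lambda>_. 1) z = 1"
    by (simp add: pi_prod_def varsigma_def rev_poly_def poly_monom)
qed

text \<open>For \<open>m = 0\<close> both products are empty (the index on the right is \<open>- 1\<close>), and the remaining factor \<open>\<sigma>\<^sub>0\<close> is 1.\<close>

lemma varsigma_Suc:
  "sgm (\<alpha> 0) = 1 \<Longrightarrow> varsigma \<alpha> (int m) = varsigma \<alpha> (int (Suc m) - 2) * sgm (\<alpha> m)"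
  by (cases m) (auto simp: varsigma_def nat_add_distrib)

context orthonormal_system
begin

text \<open>Comparing \<open>p\<^sub>n = A \<varpi>\<^sub>m\<^sup>* p\<^sub>m + B \<varpi>\<^sub>m q\<^sub>m\<close> with the first row of the recursion requires
  \<open>A = e \<eta>1 \<sigma>\<^sub>m\<close> and \<open>B = e \<eta>1 \<varsigma>\<^sub>m \<lambda>\<close>. The first equation defines \<open>e > 0\<close> and \<open>\<eta>1\<close>; the second holds because both
  \<open>p\<^sub>n(\<nu>\<^sub>m)\<close> and \<open>q\<^sub>n(\<nu>\<^sub>m)\<close> are multiples of \<open>\<varpi>\<^sub>m(\<nu>\<^sub>m) q\<^sub>m(\<nu>\<^sub>m)\<close>, with the factors \<open>B\<close> and \<open>cnj A\<close>.\<close>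

lemma unimodular_recursion:
  fixes m :: nat
  defines "n \<equiv> Suc m"
  assumes reg: "\<nu> = Gamma \<Longrightarrow> peval n (num_star n) (pt m) \<noteq> 0"
  shows "cmod (eta_par \<alpha> \<gamma> \<nu> \<phi> n) = 1"
    and "peval n (num_star n) (pt m) \<noteq> 0"
    and "\<exists>e \<eta>1 \<eta>2. e \<noteq> 0 \<and> cmod \<eta>1 = 1 \<and> cmod \<eta>2 = 1 \<and>
           (\<forall>\<eta>. cmod \<eta> = 1 \<longrightarrow>
              (normalized \<alpha> \<gamma> \<nu> n (\<lambda>z. recursion_rhs \<alpha> \<gamma> \<nu> \<phi> n (H_mat e \<eta> \<eta>2) z $ 1) \<longleftrightarrow> \<eta> = \<eta>1)) \<and>
           \<eta>2 = cnj \<eta>1 * cnj (sgm (\<alpha> m)) * sgm (\<alpha> n) \<and>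
           (\<forall>z. den n z \<noteq> 0 \<and> varpi (pt m) z \<noteq> 0 \<longrightarrow>
              vector [\<phi> n z, recip \<alpha> \<gamma> \<nu> n (\<phi> n) z] =
              recursion_rhs \<alpha> \<gamma> \<nu> \<phi> n (H_mat e \<eta>1 \<eta>2) z)"
proof -
  define v where "v = peval m (num_star m) (pt m)"
  define d where "d = diag_value (pt m)"
  have v: "v \<noteq> 0" and d: "d \<noteq> 0" "cnj d = d"
    using num_star_nonzero diag_value_pt cnj_diag_value by (auto simp: v_def d_def)
  have eta: "eta_par \<alpha> \<gamma> \<nu> \<phi> n = cnj (varsigma \<alpha> (int n - 2)) * (cnj v / v)"
    by (simp add: eta_par_def Let_def v_def n_def num_def)
  show "cmod (eta_par \<alpha> \<gamma> \<nu> \<phi> n) = 1"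
    using v by (simp add: eta norm_mult norm_divide)

  obtain A B where
    num_eq: "num n = smult A (varpi_star_poly (pt m) * num m) + smult B (varpi_poly (pt m) * num_star m)" and
    star_eq: "num_star n = smult (cnj A) (varpi_poly (pt m) * num_star m) +
                           smult (cnj B) (varpi_star_poly (pt m) * num m)"
    using num_Suc_recursion unfolding n_def by blast
  have "peval n (num n) (pt m) = B * (d * v)"
    unfolding num_eq
    by (simp add: n_def peval_add peval_smult peval_varpi_star_mult degree_num peval_varpi_num_star v_def d_def)
  moreover have "peval n (num_star n) (pt m) = cnj A * (d * v)"
    unfolding star_eq
    by (simp add: n_def peval_add peval_smult peval_varpi_star_mult degree_num peval_varpi_num_star v_def d_def)
  ultimately have val: "peval n (num n) (pt m) = B * (d * v)" "peval n (num_star n) (pt m) = cnj A * (d * v)" .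
  have A: "A \<noteq> 0"
  proof
    assume A0: "A = 0"
    show False
    proof (cases "\<nu> = Gamma")
      case True
      thus False using reg val(2) A0 by simp
    next
      case False
      thus False using num_eq A0 num_not_multiple_varpi_num_star[of m B] by (simp add: n_def)
    qed
  qed
  thus "peval n (num_star n) (pt m) \<noteq> 0" using val(2) v d(1) by simp

  define l where "l = lambda_par \<alpha> \<gamma> \<nu> \<phi> n"
  define e where "e = complex_of_real (cmod A)"
  define \<eta>1 where "\<eta>1 = A * cnj (sgm (\<alpha> m)) / of_real (cmod A)"
  define \<eta>2 where "\<eta>2 = cnj \<eta>1 * cnj (sgm (\<alpha> m)) * sgm (\<alpha> n)"
  have sgm1: "sgm x * cnj (sgm x) = 1" for x by (simp add: mult_cnj_eq_1_iff)
  have sgm0: "sgm x \<noteq> 0" for x using cmod_sgm[of x] by (metis norm_zero zero_neq_one)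
  have vs1: "varsigma \<alpha> k * cnj (varsigma \<alpha> k) = 1" for k by (simp add: mult_cnj_eq_1_iff)
  have e: "e \<noteq> 0" using A by (simp add: e_def)
  have \<eta>1: "cmod \<eta>1 = 1" using A by (simp add: \<eta>1_def norm_mult norm_divide)
  have \<eta>2: "cmod \<eta>2 = 1" using \<eta>1 by (simp add: \<eta>2_def norm_mult)
  have A_eq: "A = e * \<eta>1 * sgm (\<alpha> m)"
  proof -
    have "e * \<eta>1 * sgm (\<alpha> m) = A * (sgm (\<alpha> m) * cnj (sgm (\<alpha> m)))"
      using A by (simp add: e_def \<eta>1_def)
    thus ?thesis by (simp add: sgm1)
  qed
  have "sgm (\<alpha> 0) = 1" using adm by (simp add: admissible_poles_def sgm_def)
  hence vs: "varsigma \<alpha> (int m) = varsigma \<alpha> (int n - 2) * sgm (\<alpha> m)"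
    unfolding n_def by (rule varsigma_Suc)
  have l: "l = cnj (varsigma \<alpha> (int n - 2)) * (B / A)"
    using v d by (simp add: l_def lambda_par_def Let_def eta num_def[symmetric] n_def[symmetric] val
        field_simps) (simp add: n_def num_def[symmetric] val[unfolded n_def] d)
  have B_eq: "B = e * \<eta>1 * varsigma \<alpha> (int m) * l"
  proof -
    have "e * \<eta>1 * varsigma \<alpha> (int m) * l = A * (varsigma \<alpha> (int n - 2) * cnj (varsigma \<alpha> (int n - 2))) * (B / A)"
      unfolding vs l by (subst (2) A_eq) (simp add: mult_ac)
    thus ?thesis using A by (simp add: vs1)
  qed
  have vsn: "varsigma \<alpha> (int n) = varsigma \<alpha> (int m) * sgm (\<alpha> n)"
    by (simp add: varsigma_def n_def nat_add_distrib)
  have e_real: "cnj e = e" by (simp add: e_def)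
  \<comment> \<open>The coefficients of the reversed identity, which make up the second row; \<open>e\<close> being real
    is what makes them equal to those with \<open>\<eta>2\<close>.\<close>
  have A2: "varsigma \<alpha> (int n) * cnj A = e * \<eta>2 * varsigma \<alpha> (int m)"
    by (simp add: A_eq \<eta>2_def vsn e_real mult_ac)
  have B2: "varsigma \<alpha> (int n) * cnj B = e * \<eta>2 * cnj l * sgm (\<alpha> m)"
  proof -
    have "varsigma \<alpha> (int n) * cnj B =
      e * cnj \<eta>1 * sgm (\<alpha> n) * cnj l * (varsigma \<alpha> (int m) * cnj (varsigma \<alpha> (int m)))"
      by (simp add: B_eq vsn e_real mult_ac)
    moreover have "e * \<eta>2 * cnj l * sgm (\<alpha> m) =
      e * cnj \<eta>1 * sgm (\<alpha> n) * cnj l * (sgm (\<alpha> m) * cnj (sgm (\<alpha> m)))"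
      by (simp add: \<eta>2_def mult_ac)
    ultimately show ?thesis by (simp only: vs1 sgm1 mult_1_right)
  qed

  let ?good = "\<lambda>z. den n z \<noteq> 0 \<and> varpi (pt m) z \<noteq> 0"
  let ?rhs = "\<lambda>\<eta> z. recursion_rhs \<alpha> \<gamma> \<nu> \<phi> n (H_mat e \<eta> \<eta>2) z"
  have rhs1: "?rhs \<eta> z $ 1 = \<eta> / \<eta>1 * \<phi> n z" if z: "?good z" for \<eta> z
  proof -
    have nz: "den m z \<noteq> 0" "varpi (pt n) z \<noteq> 0" using z by (auto simp: n_def den_Suc)
    have "\<phi> n z = (e * \<eta>1) * (sgm (\<alpha> m) * varpi_star (pt m) z * poly (num m) z +
               l * (varsigma \<alpha> (int m) * varpi (pt m) z * poly (num_star m) z)) / (den m z * varpi (pt n) z)"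
      using z phi_eq[of n z] unfolding num_eq
      by (simp add: n_def den_Suc poly_varpi_poly poly_varpi_star_poly)
         (simp add: A_eq B_eq algebra_simps)
    moreover have "?rhs \<eta> z $ 1 = (e * \<eta>) * (sgm (\<alpha> m) * varpi_star (pt m) z * poly (num m) z +
               l * (varsigma \<alpha> (int m) * varpi (pt m) z * poly (num_star m) z)) / (den m z * varpi (pt n) z)"
      using z nz unfolding recursion_rhs_components l_def
      by (simp add: n_def zeta_def phi_eq recip_phi_eq divide_simps)
    moreover have "\<eta>1 \<noteq> 0" using \<eta>1 by auto
    ultimately show ?thesis by simp
  qed
  have rhs2: "?rhs \<eta>1 z $ 2 = recip \<alpha> \<gamma> \<nu> n (\<phi> n) z" if z: "?good z" for z
  proof -
    have nz: "den m z \<noteq> 0" "varpi (pt n) z \<noteq> 0" using z by (auto simp: n_def den_Suc)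
    have "recip \<alpha> \<gamma> \<nu> n (\<phi> n) z =
       ((varsigma \<alpha> (int n) * cnj A) * (varpi (pt m) z * poly (num_star m) z) +
        (varsigma \<alpha> (int n) * cnj B) * (varpi_star (pt m) z * poly (num m) z)) / (den m z * varpi (pt n) z)"
      using z recip_phi_eq[of n z] unfolding star_eq
      by (simp add: n_def den_Suc poly_varpi_poly poly_varpi_star_poly)
         (simp add: algebra_simps)
    moreover have "?rhs \<eta>1 z $ 2 = ((e * \<eta>2 * varsigma \<alpha> (int m)) * (varpi (pt m) z * poly (num_star m) z) +
        (e * \<eta>2 * cnj l * sgm (\<alpha> m)) * (varpi_star (pt m) z * poly (num m) z)) / (den m z * varpi (pt n) z)"
      using z nz unfolding recursion_rhs_components l_def
      by (simp add: n_def zeta_def phi_eq recip_phi_eq divide_simps) (simp add: algebra_simps)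
    ultimately show ?thesis by (simp add: A2 B2)
  qed
  have vec: "vector [\<phi> n z, recip \<alpha> \<gamma> \<nu> n (\<phi> n) z] = ?rhs \<eta>1 z" if "?good z" for z
    using rhs1[OF that, of \<eta>1] rhs2[OF that] \<eta>1 by (auto simp: vec_eq_iff forall_2)
  have "finite {z. \<not> ?good z}"
    using finite_zeros_pi_prod[of \<alpha> \<gamma> \<nu> n] poly_roots_finite[OF varpi_poly_nonzero, of "pt m"]
    by (auto simp: poly_varpi_poly Collect_disj_eq)
  hence norm: "normalized \<alpha> \<gamma> \<nu> n (\<lambda>z. ?rhs \<eta> z $ 1) \<longleftrightarrow> \<eta> = \<eta>1" if "cmod \<eta> = 1" for \<eta>
  proof -
    have "normalized \<alpha> \<gamma> \<nu> n (\<lambda>z. ?rhs \<eta> z $ 1) \<longleftrightarrow> \<eta> / \<eta>1 = 1"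
    proof (rule normalized_rotate[OF adm phi_in_Lspace _ _ \<open>finite {z. \<not> ?good z}\<close>])
      show "normalized \<alpha> \<gamma> \<nu> n (\<phi> n)" unfolding n_def by (rule phi_Suc(4))
      show "cmod (\<eta> / \<eta>1) = 1" using that \<eta>1 by (simp add: norm_divide)
    qed (use rhs1 in blast)
    thus ?thesis using \<eta>1 by (auto simp: field_simps)
  qed
  show "\<exists>e \<eta>1 \<eta>2. e \<noteq> 0 \<and> cmod \<eta>1 = 1 \<and> cmod \<eta>2 = 1 \<and>
           (\<forall>\<eta>. cmod \<eta> = 1 \<longrightarrow>
              (normalized \<alpha> \<gamma> \<nu> n (\<lambda>z. recursion_rhs \<alpha> \<gamma> \<nu> \<phi> n (H_mat e \<eta> \<eta>2) z $ 1) \<longleftrightarrow> \<eta> = \<eta>1)) \<and>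
           \<eta>2 = cnj \<eta>1 * cnj (sgm (\<alpha> m)) * sgm (\<alpha> n) \<and>
           (\<forall>z. den n z \<noteq> 0 \<and> varpi (pt m) z \<noteq> 0 \<longrightarrow>
              vector [\<phi> n z, recip \<alpha> \<gamma> \<nu> n (\<phi> n) z] =
              recursion_rhs \<alpha> \<gamma> \<nu> \<phi> n (H_mat e \<eta>1 \<eta>2) z)"
    by (rule exI[of _ e], rule exI[of _ \<eta>1], rule exI[of _ \<eta>2]) (use e \<eta>1 \<eta>2 norm \<eta>2_def vec in blast)
qed

end

theorem theorem5p1:
  fixes \<alpha> :: "nat \<Rightarrow> complex" and \<gamma> :: "nat \<Rightarrow> xpoint" and \<nu> :: family
    and \<mu> :: "complex measure" and \<phi> :: "nat \<Rightarrow> complex \<Rightarrow> complex" and n :: nat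
  assumes "admissible_poles \<alpha> \<gamma>"
    and "positive_ae_prob \<mu>"
    and "orthonormal_functions \<mu> \<alpha> \<gamma> \<nu> \<phi>"
    and "n \<ge> 1"
    and "\<nu> = Gamma \<Longrightarrow> peval n (rev_poly n (numer \<alpha> \<gamma> Gamma n (\<phi> n))) (\<gamma> (n - 1)) \<noteq> 0"
  shows "(\<phi> 0 = (\<lambda>_. 1) \<and> recip \<alpha> \<gamma> \<nu> 0 (\<phi> 0) = (\<lambda>_. 1))
     \<and> (cmod (eta_par \<alpha> \<gamma> \<nu> \<phi> n) = 1)
     \<and> (peval n (rev_poly n (numer \<alpha> \<gamma> \<nu> n (\<phi> n))) (pole \<alpha> \<gamma> \<nu> (n - 1)) \<noteq> 0)
     \<and> (\<exists>e \<eta>1 \<eta>2. e \<noteq> 0 \<and> cmod \<eta>1 = 1 \<and> cmod \<eta>2 = 1 \<and>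
           (\<forall>\<eta>. cmod \<eta> = 1 \<longrightarrow>
              (normalized \<alpha> \<gamma> \<nu> n (\<lambda>z. recursion_rhs \<alpha> \<gamma> \<nu> \<phi> n (H_mat e \<eta> \<eta>2) z $ 1) \<longleftrightarrow> \<eta> = \<eta>1)) \<and>
           \<eta>2 = cnj \<eta>1 * cnj (sgm (\<alpha> (n - 1))) * sgm (\<alpha> n) \<and>
           (\<forall>z. pi_prod \<alpha> \<gamma> \<nu> n z \<noteq> 0 \<and> varpi (pole \<alpha> \<gamma> \<nu> (n - 1)) z \<noteq> 0 \<longrightarrow>
              vector [\<phi> n z, recip \<alpha> \<gamma> \<nu> n (\<phi> n) z] =
              recursion_rhs \<alpha> \<gamma> \<nu> \<phi> n (H_mat e \<eta>1 \<eta>2) z))"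
proof -
  interpret orthonormal_system \<alpha> \<gamma> \<nu> \<mu> \<phi>
    using assms(1-3) by unfold_locales
  obtain m where n: "n = Suc m" using assms(4) by (cases n) auto
  have m: "n - 1 = m" by (simp add: n)
  have reg: "peval n (num_star n) (pt m) \<noteq> 0" if "\<nu> = Gamma"
    using assms(5)[OF that] unfolding num_def unfolding m that by simp
  note rec = unimodular_recursion[of m, folded n, OF reg]
  show ?thesis
    unfolding m using rec phi_0 recip_const_1[OF adm] by (auto simp: num_def)
qed

end
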